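(* Let $\mathcal{K}$ be an even (bicolored) triangulation of the $2$-sphere with $n$ vertices labeled by $\{1,\ldots,n\}$, and let $\Gamma$ and $\Gamma'$ be its black and white hypertrees. Then $\Gamma$ and $\Gamma'$ give the same divisor on $\overline{M}_{0,n}$: $D_\Gamma=D_{\Gamma'}$.
   Context: We work over an algebraically closed field $k$. A triangulation of the $2$-sphere (a simplicial complex homeomorphic to $S^2$) is even (bicolored) if its triangles are colored black and white so that any two triangles sharing an edge have different colors. Its black (resp. white) hypertree is the collection of vertex sets of its black (resp. white) triangles. $D_\Gamma$ for a collection of triples $\Gamma=\{\Gamma_1,\ldots,\Gamma_{n-2}\}$ on $\{1,\ldots,n\}$: let $G^2(\Gamma)\subset M_{0,n}$ be the closed locus of points $(\mathbb{P}^1;q_1,\ldots,q_n)$ for which there are distinct points $p_1,\ldots,p_n\in\mathbb{P}^2$, not all on one line, such that for each $j$ the points $\{p_i\}_{i\in\Gamma_j}$ are collinear, and a point $p\in\mathbb{P}^2$ such that linear projection from $p$ sends $p_1,\ldots,p_n$ to $q_1,\ldots,q_n$. $D_\Gamma$ is the closure of $G^2(\Gamma)$ in $\overline{M}_{0,n}$. (For irreducible hypertrees this coincides with the closure of the locus where moreover a set $\{p_i\}_{i\in S}$, $|S|\ge3$, is collinear only if $S\subset\Gamma_j$ for some $j$.) *)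

theory Defs
  imports "HOL-Analysis.Analysis" "HOL-Computational_Algebra.Polynomial"
begin

section \<open>Projective points and lines\<close>

text \<open>Points of the projective space of lines in a coordinate space over a field are
  one-dimensional subspaces; projective lines are two-dimensional ones.\<close>

definition proj_points :: "('k::field ^ 'n) set set" where
  "proj_points = {L. vec.subspace L \<and> vec.dim L = 1}"

definition proj_lines :: "('k::field ^ 'n) set set" where
  "proj_lines = {H. vec.subspace H \<and> vec.dim H = 2}"

definition proj_collinear :: "('k::field ^ 'n) set set \<Rightarrow> bool" where
  "proj_collinear P \<longleftrightarrow> (\<exists>H\<in>proj_lines. \<forall>L\<in>P. L \<subseteq> H)"

abbreviation proj_map :: "'k::field ^ 'n ^ 'm \<Rightarrow> ('k ^ 'n) set \<Rightarrow> ('k ^ 'm) set" where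
  "proj_map A L \<equiv> (*v) A ` L"

definition is_cross_ratio ::
  "('k::field ^ 2) set \<Rightarrow> ('k ^ 2) set \<Rightarrow> ('k ^ 2) set \<Rightarrow> ('k ^ 2) set \<Rightarrow> ('k ^ 2) set \<Rightarrow> bool" where
  "is_cross_ratio a b c d e \<longleftrightarrow>
     (\<exists>A :: 'k ^ 2 ^ 2. invertible A \<and>
        proj_map A a = vec.span {vector [1, 0]} \<and>
        proj_map A b = vec.span {vector [0, 1]} \<and>
        proj_map A c = vec.span {vector [1, 1]} \<and>
        e = proj_map A d)"


section \<open>The Zariski topology on a finite product of projective lines\<close>

text \<open>Polynomial functions in the homogeneous coordinates \<open>a t $ 1\<close>, \<open>a t $ 2\<close> for
  \<open>t \<in> I\<close>.\<close>

inductive_set poly_funs :: "'i set \<Rightarrow> (('i \<Rightarrow> 'k::field ^ 2) \<Rightarrow> 'k) set" for I :: "'i set" where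
  const: "(\<lambda>a. c) \<in> poly_funs I"
| coord: "t \<in> I \<Longrightarrow> (\<lambda>a. a t $ s) \<in> poly_funs I"
| add: "f \<in> poly_funs I \<Longrightarrow> g \<in> poly_funs I \<Longrightarrow> (\<lambda>a. f a + g a) \<in> poly_funs I"
| mult: "f \<in> poly_funs I \<Longrightarrow> g \<in> poly_funs I \<Longrightarrow> (\<lambda>a. f a * g a) \<in> poly_funs I"

text \<open>Over an infinite field (in particular over an algebraically closed one) a polynomial
  function scales as below iff the underlying polynomial is multihomogeneous.\<close>

definition multihom_funs :: "'i set \<Rightarrow> (('i \<Rightarrow> 'k::field ^ 2) \<Rightarrow> 'k) set" where
  "multihom_funs I = {f \<in> poly_funs I.
     \<exists>d :: 'i \<Rightarrow> nat. \<forall>c a. f (\<lambda>t. c t *s a t) = (\<Prod>t\<in>I. c t ^ d t) * f a}"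

definition vanishes_at ::
  "'i set \<Rightarrow> (('i \<Rightarrow> 'k::field ^ 2) \<Rightarrow> 'k) \<Rightarrow> ('i \<Rightarrow> ('k ^ 2) set) \<Rightarrow> bool" where
  "vanishes_at I f x \<longleftrightarrow> (\<forall>a. (\<forall>t\<in>I. a t \<in> x t - {0}) \<longrightarrow> f a = 0)"

definition zero_locus ::
  "'i set \<Rightarrow> (('i \<Rightarrow> 'k::field ^ 2) \<Rightarrow> 'k) set \<Rightarrow> ('i \<Rightarrow> ('k ^ 2) set) set" where
  "zero_locus I F = {x \<in> PiE I (\<lambda>_. proj_points). \<forall>f\<in>F. vanishes_at I f x}"

definition zariski_topology :: "'i set \<Rightarrow> ('i \<Rightarrow> ('k::field ^ 2) set) topology" where
  "zariski_topology I = topology (\<lambda>U. U \<subseteq> PiE I (\<lambda>_. proj_points) \<and>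
     (\<exists>F \<subseteq> multihom_funs I. PiE I (\<lambda>_. proj_points) - U = zero_locus I F))"

lemma proj_points_nonzero:
  assumes "L \<in> proj_points" obtains v where "v \<in> L" "v \<noteq> 0"
proof -
  have "vec.dim L = 1" using assms by (simp add: proj_points_def)
  moreover have "L \<subseteq> {0} \<Longrightarrow> vec.dim L = 0"
    by (simp add: vec.dim_eq_0)
  ultimately show thesis using that by fastforce
qed

lemma proj_points_proportional:
  assumes "L \<in> proj_points" "v \<in> L" "w \<in> L" "v \<noteq> 0" "w \<noteq> 0"
  obtains c where "c \<noteq> 0" "w = c *s v"
proof -
  have sub: "vec.subspace L" and dim: "vec.dim L = 1"
    using assms by (auto simp: proj_points_def)
  have "vec.independent {v}" using assms by (simp add: vec.dependent_single)
  then have "L \<subseteq> vec.span {v}"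
    using dim assms(2) by (intro vec.card_ge_dim_independent) auto
  then have "w \<in> vec.span {v}" using assms by blast
  then obtain c where "w = c *s v" by (auto simp: vec.span_singleton)
  then show thesis using that assms(5) by auto
qed

lemma poly_funs_cong:
  assumes "f \<in> poly_funs I" "\<forall>t\<in>I. a t = b t"
  shows "f a = f b"
  using assms by (induction rule: poly_funs.induct) auto

lemma multihom_funs_mult:
  assumes "f \<in> multihom_funs I" "g \<in> multihom_funs I"
  shows "(\<lambda>a. f a * g a) \<in> multihom_funs I"
proof -
  obtain d where d: "\<forall>c a. f (\<lambda>t. c t *s a t) = (\<Prod>t\<in>I. c t ^ d t) * f a"
    using assms(1) by (auto simp: multihom_funs_def)
  obtain e where e: "\<forall>c a. g (\<lambda>t. c t *s a t) = (\<Prod>t\<in>I. c t ^ e t) * g a"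
    using assms(2) by (auto simp: multihom_funs_def)
  have "\<forall>c a. f (\<lambda>t. c t *s a t) * g (\<lambda>t. c t *s a t)
        = (\<Prod>t\<in>I. c t ^ (d t + e t)) * (f a * g a)"
    using d e by (simp add: power_add prod.distrib)
  moreover have "(\<lambda>a. f a * g a) \<in> poly_funs I"
    using assms by (auto simp: multihom_funs_def intro: poly_funs.mult)
  ultimately show ?thesis
    unfolding multihom_funs_def by (intro CollectI conjI exI[of _ "\<lambda>t. d t + e t"])
qed

lemma multihom_funs_one: "finite I \<Longrightarrow> (\<lambda>a. 1) \<in> multihom_funs I"
  unfolding multihom_funs_def
  by (auto intro!: poly_funs.const exI[of _ "\<lambda>_. 0"])

lemma vanishes_at_mult:
  fixes f g :: "('i \<Rightarrow> 'k::field ^ 2) \<Rightarrow> 'k"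
  assumes "finite I" "f \<in> multihom_funs I" "g \<in> multihom_funs I" "x \<in> PiE I (\<lambda>_. proj_points)"
  shows "vanishes_at I (\<lambda>a. f a * g a) x \<longleftrightarrow> vanishes_at I f x \<or> vanishes_at I g x"
proof
  assume "vanishes_at I f x \<or> vanishes_at I g x"
  then show "vanishes_at I (\<lambda>a. f a * g a) x" unfolding vanishes_at_def by auto
next
  assume fg: "vanishes_at I (\<lambda>a. f a * g a) x"
  show "vanishes_at I f x \<or> vanishes_at I g x"
  proof (rule ccontr)
    assume "\<not> ?thesis"
    then obtain a b where a: "\<forall>t\<in>I. a t \<in> x t - {0}" "f a \<noteq> 0"
      and b: "\<forall>t\<in>I. b t \<in> x t - {0}" "g b \<noteq> 0"
      unfolding vanishes_at_def by auto
    have "\<exists>c. c \<noteq> 0 \<and> b t = c *s a t" if t: "t \<in> I" for t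
    proof -
      have "x t \<in> proj_points" using assms(4) t by auto
      moreover have "a t \<in> x t" "a t \<noteq> 0" "b t \<in> x t" "b t \<noteq> 0" using a b t by auto
      ultimately show ?thesis by (metis proj_points_proportional)
    qed
    then obtain c where c: "\<And>t. t \<in> I \<Longrightarrow> c t \<noteq> 0 \<and> b t = c t *s a t" by metis
    obtain d where d: "\<And>c a. g (\<lambda>t. c t *s a t) = (\<Prod>t\<in>I. c t ^ d t) * g a"
      using assms(3) by (auto simp: multihom_funs_def)
    have "g \<in> poly_funs I" using assms(3) by (simp add: multihom_funs_def)
    then have "g b = g (\<lambda>t. c t *s a t)" by (rule poly_funs_cong) (use c in auto)
    then have "g a \<noteq> 0" using d[of c a] b(2) by auto
    then show False using fg a unfolding vanishes_at_def by auto
  qed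
qed

lemma zero_locus_Un:
  fixes F G :: "(('i \<Rightarrow> 'k::field ^ 2) \<Rightarrow> 'k) set"
  assumes I: "finite I" and F: "F \<subseteq> multihom_funs I" and G: "G \<subseteq> multihom_funs I"
  shows "zero_locus I F \<union> zero_locus I G
    = zero_locus I ((\<lambda>(f, g) a. f a * g a) ` (F \<times> G))"
proof -
  have "x \<in> zero_locus I F \<union> zero_locus I G
      \<longleftrightarrow> x \<in> zero_locus I ((\<lambda>(f, g) a. f a * g a) ` (F \<times> G))" for x
  proof (cases "x \<in> PiE I (\<lambda>_. proj_points)")
    case True
    have "x \<in> zero_locus I ((\<lambda>(f, g) a. f a * g a) ` (F \<times> G))
        \<longleftrightarrow> (\<forall>f\<in>F. \<forall>g\<in>G. vanishes_at I (\<lambda>a. f a * g a) x)"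
      using True by (simp add: zero_locus_def)
    also have "\<dots> \<longleftrightarrow> (\<forall>f\<in>F. \<forall>g\<in>G. vanishes_at I f x \<or> vanishes_at I g x)"
      using vanishes_at_mult[OF I _ _ True] F G by (meson subsetD)
    also have "\<dots> \<longleftrightarrow> x \<in> zero_locus I F \<union> zero_locus I G"
      using True by (auto simp: zero_locus_def)
    finally show ?thesis by simp
  qed (simp add: zero_locus_def)
  then show ?thesis by blast
qed

lemma istopology_zariski:
  fixes I :: "'i set"
  assumes "finite I"
  shows "istopology (\<lambda>U :: ('i \<Rightarrow> ('k::field ^ 2) set) set. U \<subseteq> PiE I (\<lambda>_. proj_points) \<and>
     (\<exists>F \<subseteq> multihom_funs I. PiE I (\<lambda>_. proj_points) - U = zero_locus I F))"
    (is "istopology ?open")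
  unfolding istopology_def
proof (intro conjI allI impI)
  fix U V assume "?open U" "?open V"
  then obtain F G where U: "U \<subseteq> PiE I (\<lambda>_. proj_points)"
    and FG: "F \<subseteq> multihom_funs I" "G \<subseteq> multihom_funs I"
    "PiE I (\<lambda>_. proj_points) - U = zero_locus I F" "PiE I (\<lambda>_. proj_points) - V = zero_locus I G"
    by auto
  let ?H = "(\<lambda>(f, g) a. f a * g a) ` (F \<times> G)"
  have "?H \<subseteq> multihom_funs I" using FG(1,2) by (auto intro!: multihom_funs_mult)
  moreover have "PiE I (\<lambda>_. proj_points) - (U \<inter> V) = zero_locus I ?H"
    by (simp only: Diff_Int FG(3,4) zero_locus_Un[OF assms FG(1,2)])
  ultimately show "\<exists>F \<subseteq> multihom_funs I. PiE I (\<lambda>_. proj_points) - (U \<inter> V) = zero_locus I F"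
    by (rule exI[of _ ?H, OF conjI])
  show "U \<inter> V \<subseteq> PiE I (\<lambda>_. proj_points)" using U by blast
next
  fix \<U> assume U: "\<forall>U\<in>\<U>. ?open U"
  then show "\<Union>\<U> \<subseteq> PiE I (\<lambda>_. proj_points)" by blast
  from U have "\<forall>U\<in>\<U>. \<exists>F. F \<subseteq> multihom_funs I \<and>
      PiE I (\<lambda>_. proj_points) - U = zero_locus I F" by simp
  then obtain F where F: "\<forall>U\<in>\<U>. F U \<subseteq> multihom_funs I \<and>
      PiE I (\<lambda>_. proj_points) - U = zero_locus I (F U)" by (rule bchoice[THEN exE])
  have "zero_locus I (\<Union>(F ` \<U>)) = PiE I (\<lambda>_. proj_points) - \<Union>\<U>"
  proof -
    have "zero_locus I (\<Union>(F ` \<U>)) =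
      {x \<in> PiE I (\<lambda>_. proj_points). \<forall>U\<in>\<U>. x \<in> zero_locus I (F U)}"
      by (auto simp: zero_locus_def)
    also have "\<dots> = {x \<in> PiE I (\<lambda>_. proj_points). \<forall>U\<in>\<U>. x \<in> PiE I (\<lambda>_. proj_points) - U}"
      using F by simp
    finally show ?thesis by auto
  qed
  moreover have "\<Union>(F ` \<U>) \<subseteq> multihom_funs I" using F by auto
  ultimately show "\<exists>F \<subseteq> multihom_funs I.
      PiE I (\<lambda>_. proj_points) - \<Union>\<U> = zero_locus I F"
    by (intro exI[of _ "\<Union>(F ` \<U>)"] conjI) simp_all
qed

lemma openin_zariski:
  fixes I :: "'i set" and U :: "('i \<Rightarrow> ('k::field ^ 2) set) set"
  assumes "finite I"
  shows "openin (zariski_topology I) U \<longleftrightarrow> U \<subseteq> PiE I (\<lambda>_. proj_points) \<and>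
     (\<exists>F \<subseteq> multihom_funs I. PiE I (\<lambda>_. proj_points) - U = zero_locus I F)"
  unfolding zariski_topology_def by (simp add: istopology_zariski[OF assms])

lemma topspace_zariski:
  assumes "finite I"
  shows "topspace (zariski_topology I :: ('i \<Rightarrow> ('k::field ^ 2) set) topology)
    = PiE I (\<lambda>_. proj_points)"
proof -
  have "zero_locus I {\<lambda>a. 1} = ({} :: ('i \<Rightarrow> ('k ^ 2) set) set)"
  proof (rule ccontr)
    assume "\<not> ?thesis"
    then obtain x :: "'i \<Rightarrow> ('k ^ 2) set" where x: "x \<in> zero_locus I {\<lambda>a. 1}" by blast
    then have "\<forall>t\<in>I. \<exists>v. v \<in> x t - {0}"
      unfolding zero_locus_def by (fastforce elim: proj_points_nonzero)
    then obtain a where "\<forall>t\<in>I. a t \<in> x t - {0}" by metis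
    then show False using x unfolding zero_locus_def vanishes_at_def by auto
  qed
  then have "openin (zariski_topology I)
      (PiE I (\<lambda>_. proj_points) :: ('i \<Rightarrow> ('k ^ 2) set) set)"
    unfolding openin_zariski[OF assms]
    using multihom_funs_one[OF assms]
    by (intro conjI order_refl exI[of _ "{\<lambda>a. 1}"]) auto
  then have "PiE I (\<lambda>_. proj_points) \<subseteq> topspace (zariski_topology I :: ('i \<Rightarrow> ('k ^ 2) set) topology)"
    by (rule openin_subset)
  moreover have "openin (zariski_topology I :: ('i \<Rightarrow> ('k ^ 2) set) topology) (topspace (zariski_topology I))"
    by (rule openin_topspace)
  ultimately show ?thesis unfolding openin_zariski[OF assms] by blast
qed


section \<open>Stable pointed rational curves and their moduli space\<close>

text \<open>A pointed nodal curve all of whose components are projective lines and whose dual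
  graph is a tree.  The component \<open>v\<close> is a copy of the projective line; for adjacent
  components, the point \<open>node C v w\<close> of \<open>v\<close> is glued to the point \<open>node C w v\<close> of \<open>w\<close>.  The
  \<open>i\<close>-th marked point is the point \<open>mark C i\<close> of the component \<open>home C i\<close>; only
  \<open>1 \<le> i \<le> n\<close> matters.\<close>

record 'k pointed_curve =
  comps :: "nat set"
  adj :: "(nat \<times> nat) set"
  node :: "nat \<Rightarrow> nat \<Rightarrow> ('k ^ 2) set"
  home :: "nat \<Rightarrow> nat"
  mark :: "nat \<Rightarrow> ('k ^ 2) set"

text \<open>A nonempty finite connected graph in which every edge is a bridge.\<close>

definition is_tree :: "nat set \<Rightarrow> (nat \<times> nat) set \<Rightarrow> bool" where
  "is_tree V E \<longleftrightarrow> finite V \<and> V \<noteq> {} \<and> E \<subseteq> V \<times> V \<and> sym E \<and> irrefl E \<and>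
     (\<forall>v\<in>V. \<forall>w\<in>V. (v, w) \<in> E\<^sup>*) \<and>
     (\<forall>(v, w)\<in>E. (v, w) \<notin> (E - {(v, w), (w, v)})\<^sup>*)"

definition stable_curve :: "nat \<Rightarrow> 'k::field pointed_curve \<Rightarrow> bool" where
  "stable_curve n C \<longleftrightarrow> is_tree (comps C) (adj C) \<and>
     (\<forall>(v, w)\<in>adj C. node C v w \<in> proj_points) \<and>
     (\<forall>i\<in>{1..n}. home C i \<in> comps C \<and> mark C i \<in> proj_points) \<and>
     (\<forall>v w w'. (v, w) \<in> adj C \<and> (v, w') \<in> adj C \<and> w \<noteq> w' \<longrightarrow> node C v w \<noteq> node C v w') \<and>
     (\<forall>i\<in>{1..n}. \<forall>j\<in>{1..n}. i \<noteq> j \<and> home C i = home C j \<longrightarrow> mark C i \<noteq> mark C j) \<and>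
     (\<forall>i\<in>{1..n}. \<forall>w. (home C i, w) \<in> adj C \<longrightarrow> mark C i \<noteq> node C (home C i) w) \<and>
     (\<forall>v\<in>comps C. card {i \<in> {1..n}. home C i = v} + card {w. (v, w) \<in> adj C} \<ge> 3)"

definition curve_iso :: "nat \<Rightarrow> 'k::field pointed_curve \<Rightarrow> 'k pointed_curve \<Rightarrow> bool" where
  "curve_iso n C C' \<longleftrightarrow>
     (\<exists>(\<sigma> :: nat \<Rightarrow> nat) (A :: nat \<Rightarrow> 'k ^ 2 ^ 2).
        bij_betw \<sigma> (comps C) (comps C') \<and>
        (\<forall>v\<in>comps C. invertible (A v)) \<and>
        (\<forall>v\<in>comps C. \<forall>w\<in>comps C. (v, w) \<in> adj C \<longleftrightarrow> (\<sigma> v, \<sigma> w) \<in> adj C') \<and>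
        (\<forall>(v, w)\<in>adj C. node C' (\<sigma> v) (\<sigma> w) = proj_map (A v) (node C v w)) \<and>
        (\<forall>i\<in>{1..n}. home C' i = \<sigma> (home C i) \<and>
           mark C' i = proj_map (A (home C i)) (mark C i)))"

definition iso_rel :: "nat \<Rightarrow> ('k::field pointed_curve \<times> 'k pointed_curve) set" where
  "iso_rel n = {(C, C'). stable_curve n C \<and> stable_curve n C' \<and> curve_iso n C C'}"

definition moduli_space :: "nat \<Rightarrow> 'k::field pointed_curve set set" where
  "moduli_space n = {C. stable_curve n C} // iso_rel n"

text \<open>The image of the \<open>i\<close>-th marked point under the retraction of the curve onto its
  component \<open>v\<close>: the marked point itself, or the node of \<open>v\<close> through which it is reached.\<close>

definition retract :: "'k::field pointed_curve \<Rightarrow> nat \<Rightarrow> nat \<Rightarrow> ('k ^ 2) set" where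
  "retract C v i = (if home C i = v then mark C i
     else node C v (THE w. (v, w) \<in> adj C \<and> (w, home C i) \<in> (Restr (adj C) (comps C - {v}))\<^sup>*))"

definition quads :: "nat \<Rightarrow> (nat \<times> nat \<times> nat \<times> nat) set" where
  "quads n = {(i, j, k, l). {i, j, k, l} \<subseteq> {1..n} \<and> distinct [i, j, k, l]}"

text \<open>The maps forgetting all but four marked points, with the moduli space of stable
  four-pointed curves identified with the projective line: forgetting and stabilising
  contracts the curve onto the only component on which the points \<open>i\<close>, \<open>j\<close>, \<open>k\<close> have
  distinct retractions, and the cross-ratio is formed there (the matrix in
  \<open>is_cross_ratio\<close> forces the first three points to be distinct).\<close>

definition cross_ratios ::
  "nat \<Rightarrow> 'k::field pointed_curve set \<Rightarrow> nat \<times> nat \<times> nat \<times> nat \<Rightarrow> ('k ^ 2) set" where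
  "cross_ratios n X = (\<lambda>(i, j, k, l)\<in>quads n. THE e. \<exists>C\<in>X. \<exists>v\<in>comps C.
     is_cross_ratio (retract C v i) (retract C v j) (retract C v k) (retract C v l) e)"

text \<open>The product of these maps is a closed embedding of the moduli space of stable
  \<open>n\<close>-pointed rational curves into a product of projective lines (Gerritzen, Herrlich and
  van der Put, Stable n-pointed trees of projective lines), so its Zariski topology is the
  induced one.\<close>

definition moduli_topology :: "nat \<Rightarrow> 'k::field pointed_curve set topology" where
  "moduli_topology n = pullback_topology (moduli_space n) (cross_ratios n) (zariski_topology (quads n))"

text \<open>The point of the open stratum given by \<open>n\<close> distinct points of the projective line.\<close>

definition line_curve :: "(nat \<Rightarrow> ('k ^ 2) set) \<Rightarrow> 'k::field pointed_curve" where
  "line_curve q = \<lparr>comps = {0}, adj = {}, node = (\<lambda>_ _. {}), home = (\<lambda>_. 0), mark = q\<rparr>"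

definition distinct_points :: "nat \<Rightarrow> (nat \<Rightarrow> ('k::field ^ 'm) set) \<Rightarrow> bool" where
  "distinct_points n q \<longleftrightarrow> q ` {1..n} \<subseteq> proj_points \<and> inj_on q {1..n}"

definition open_moduli_space :: "nat \<Rightarrow> 'k::field pointed_curve set set" where
  "open_moduli_space n = {iso_rel n `` {line_curve q} | q. distinct_points n q}"


section \<open>The locus of a collection of triples\<close>

text \<open>A linear projection of the projective plane to the projective line is induced by a
  matrix whose kernel is the centre of projection.  A point of the plane distinct from the
  centre is thus sent to a point of the line.\<close>

definition projects_from ::
  "nat \<Rightarrow> ('k::field ^ 3) set \<Rightarrow> (nat \<Rightarrow> ('k ^ 3) set) \<Rightarrow> (nat \<Rightarrow> ('k ^ 2) set) \<Rightarrow> bool" where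
  "projects_from n c p q \<longleftrightarrow>
     (\<exists>A :: 'k ^ 3 ^ 2. {x. A *v x = 0} = c \<and> (\<forall>i\<in>{1..n}. p i \<noteq> c \<and> proj_map A (p i) = q i))"

definition G2 :: "nat \<Rightarrow> nat set set \<Rightarrow> 'k::field pointed_curve set set" where
  "G2 n \<Gamma> = {X \<in> open_moduli_space n. \<exists>q. distinct_points n q \<and> X = iso_rel n `` {line_curve q} \<and>
     (\<exists>p. distinct_points n p \<and> \<not> proj_collinear (p ` {1..n}) \<and>
        (\<forall>T\<in>\<Gamma>. proj_collinear (p ` T)) \<and>
        (\<exists>c\<in>proj_points. projects_from n c p q))}"

definition D :: "nat \<Rightarrow> nat set set \<Rightarrow> 'k::field pointed_curve set set" where
  "D n \<Gamma> = moduli_topology n closure_of G2 n \<Gamma>"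


section \<open>Even triangulations of the sphere and their hypertrees\<close>

datatype colour = Black | White

definition triangles :: "'a::euclidean_space set set \<Rightarrow> 'a set set" where
  "triangles K = {T \<in> K. 2 simplex T}"

definition even_sphere_triangulation ::
  "'a::euclidean_space set set \<Rightarrow> ('a set \<Rightarrow> colour) \<Rightarrow> bool" where
  "even_sphere_triangulation K col \<longleftrightarrow>
     simplicial_complex K \<and> \<Union>K homeomorphic (sphere 0 1 :: (real ^ 3) set) \<and>
     (\<forall>S\<in>triangles K. \<forall>T\<in>triangles K.
        S \<noteq> T \<and> (\<exists>E\<in>K. 1 simplex E \<and> E \<subseteq> S \<and> E \<subseteq> T) \<longrightarrow> col S \<noteq> col T)"

definition vertex_labelling :: "nat \<Rightarrow> 'a::euclidean_space set set \<Rightarrow> (nat \<Rightarrow> 'a) \<Rightarrow> bool" where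
  "vertex_labelling n K vert \<longleftrightarrow> bij_betw vert {1..n} {x. {x} \<in> K}"

definition hypertree ::
  "nat \<Rightarrow> 'a::euclidean_space set set \<Rightarrow> ('a set \<Rightarrow> colour) \<Rightarrow> (nat \<Rightarrow> 'a) \<Rightarrow> colour \<Rightarrow> nat set set" where
  "hypertree n K col vert h =
     {{i \<in> {1..n}. vert i extreme_point_of T} | T. T \<in> triangles K \<and> col T = h}"

end

theory Submission
  imports Defs "HOL-Library.Z2"
begin

text \<open>In fact \<open>G2\<close> itself is the same for both hypertrees.  Choose a coordinate \<open>z\<close> on the line
  in which all marked points are finite.  Configurations in the plane projecting to them are given by
  a further coordinate \<open>y\<close> of the points, and three of them are collinear iff \<open>y\<close> is an affine
  function of \<open>z\<close> on the triple.  If \<open>y\<close> is affine on the black triangles, with slopes \<open>s\<close>, then every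
  edge lies in one black triangle and \<open>dy = s * dz\<close> on it; conversely, as the sphere is simply
  connected, slopes come from some \<open>y\<close> iff these increments sum to zero around each white triangle.
  On the oriented sphere this linear system is square, and its transpose is the system of the white
  hypertree.  Constant slopes are the globally affine functions, so for both colours the condition
  is that the corank be at least two.\<close>


section \<open>Locally defined cocycles\<close>

text \<open>Simple connectedness is a property of the space, while slopes and increments live on
  vertex labels. The bridge is to choose for every point a vertex whose open star contains a whole
  neighbourhood of it; a cocycle on vertices then becomes a function of pairs of nearby points,
  which can be summed along paths. The coefficients form an arbitrary abelian group because this is
  used twice: modulo two for the orientation, and over the field for \<open>y\<close>. The system is
  square because every edge lies in exactly one triangle of each colour: invariance of domain gives
  at least two triangles on an edge, and the colouring rule allows at most one of each colour. The
  transpose is the white system only if both colours induce the same direction on a common edge. An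
  orientation of a surface induces opposite directions from the two sides of an edge; since the
  sides have different colours, reversing all white triangles makes the directions agree. They are
  found from the links of the vertices, in which black and white edges alternate.\<close>

lemma locally_constant_on_connected:
  fixes f :: "'m::metric_space \<Rightarrow> 'b"
  assumes "connected S" "\<epsilon> > 0"
    and loc: "\<And>x y. x \<in> S \<Longrightarrow> y \<in> S \<Longrightarrow> dist x y < \<epsilon> \<Longrightarrow> f x = f y"
    and "x \<in> S" "y \<in> S"
  shows "f x = f y"
proof (rule connected_equivalence_relation[OF assms(1,4,5)])
  fix a assume a: "a \<in> S"
  show "\<exists>T. openin (top_of_set S) T \<and> a \<in> T \<and> (\<forall>x\<in>T. f a = f x)"
  proof (intro exI conjI ballI)
    show "openin (top_of_set S) (S \<inter> ball a \<epsilon>)" by (simp add: openin_open_Int)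
    show "a \<in> S \<inter> ball a \<epsilon>" using a \<open>\<epsilon> > 0\<close> by simp
    show "f a = f x" if "x \<in> S \<inter> ball a \<epsilon>" for x using that by (intro loc a) auto
  qed
qed simp_all

text \<open>An Alexander-Spanier 1-cocycle, with a uniform scale \<delta> in place of an unspecified
  neighbourhood of the diagonal.\<close>

definition local_cocycle :: "real \<Rightarrow> 'm::metric_space set \<Rightarrow> ('m \<Rightarrow> 'm \<Rightarrow> 'g::ab_group_add) \<Rightarrow> bool" where
  "local_cocycle \<delta> S C \<longleftrightarrow> (\<forall>x\<in>S. \<forall>y\<in>S. \<forall>z\<in>S.
     dist x y < \<delta> \<and> dist y z < \<delta> \<and> dist x z < \<delta> \<longrightarrow> C x y + C y z = C x z)"

lemma local_cocycleD:
  assumes "local_cocycle \<delta> S C" "x \<in> S" "y \<in> S" "z \<in> S" "dist x y < \<delta>" "dist y z < \<delta>" "dist x z < \<delta>"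
  shows "C x y + C y z = C x z"
  using assms unfolding local_cocycle_def by blast

lemma local_cocycle_diag:
  assumes "local_cocycle \<delta> S C" "\<delta> > 0" "x \<in> S"
  shows "C x x = 0"
  using local_cocycleD[OF assms(1) assms(3) assms(3) assms(3)] assms(2) by simp

lemma local_cocycle_pullback:
  assumes C: "local_cocycle \<delta> S C" "\<delta> > 0"
    and f: "continuous_on X f" "compact X" "f ` X \<subseteq> S"
  obtains \<epsilon> where "\<epsilon> > 0" "local_cocycle \<epsilon> X (\<lambda>x y. C (f x) (f y))"
proof -
  have "uniformly_continuous_on X f" using f by (rule_tac compact_uniformly_continuous)
  then obtain \<epsilon> where "\<epsilon> > 0" and e: "\<And>x y. x \<in> X \<Longrightarrow> y \<in> X \<Longrightarrow> dist x y < \<epsilon> \<Longrightarrow> dist (f x) (f y) < \<delta>"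
    using C(2) unfolding uniformly_continuous_on_def by metis
  have "local_cocycle \<epsilon> X (\<lambda>x y. C (f x) (f y))"
    unfolding local_cocycle_def
    by (intro ballI impI local_cocycleD[OF C(1)]) (use f(3) in \<open>auto intro!: e\<close>)
  then show thesis using that \<open>\<epsilon> > 0\<close> by blast
qed

text \<open>The potential is the sum of the cocycle along a fine subdivision of the segment from a
  base point; moving the end point changes it by the cocycle, by commutativity of the squares
  of a ladder.\<close>

lemma local_cocycle_convex_exact:
  fixes C :: "'m::real_normed_vector \<Rightarrow> 'm \<Rightarrow> 'g::ab_group_add"
  assumes "convex S" "bounded S" and C: "local_cocycle \<delta> S C" "\<delta> > 0"
  obtains \<phi> \<epsilon> where "\<epsilon> > 0"
    "\<And>x y. x \<in> S \<Longrightarrow> y \<in> S \<Longrightarrow> dist x y < \<epsilon> \<Longrightarrow> C x y = \<phi> y - \<phi> x"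
proof (cases "S = {}")
  case True
  then show thesis using that[of 1] by auto
next
  case False
  then obtain a where a: "a \<in> S" by blast
  obtain B where B: "\<And>x. x \<in> S \<Longrightarrow> dist a x \<le> B"
    using assms(2) unfolding bounded_any_center[of S a] by blast
  \<comment> \<open>Half of \<delta>, because a diagonal of the ladder is bounded by a step plus a
    rung.\<close>
  obtain N :: nat where N0: "N > 0" and N: "B < real N * (\<delta> / 2)"
  proof -
    obtain N :: nat where "B / (\<delta> / 2) < real N" using reals_Archimedean2 by blast
    then have "B < real N * (\<delta> / 2)" using C(2) by (simp add: field_simps)
    moreover have "B \<ge> 0" using B[OF a] by simp
    ultimately show thesis using that C(2) by (cases "N = 0") auto
  qed
  define pt where "pt x i = a + (real i / real N) *\<^sub>R (x - a)" for x i
  have ptS: "pt x i \<in> S" if "x \<in> S" "i \<le> N" for x i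
  proof -
    have "pt x i = (1 - real i / real N) *\<^sub>R a + (real i / real N) *\<^sub>R x"
      by (simp add: pt_def algebra_simps)
    then show ?thesis using convexD_alt[OF assms(1) a that(1), of "real i / real N"] that(2) N0 by simp
  qed
  have step: "dist (pt x i) (pt x (Suc i)) < \<delta> / 2" if "x \<in> S" for x i
  proof -
    have "pt x (Suc i) - pt x i = (1 / real N) *\<^sub>R (x - a)"
      by (simp add: pt_def add_divide_distrib scaleR_left_distrib)
    then have "dist (pt x i) (pt x (Suc i)) = dist a x / real N"
      by (metis (no_types) dist_norm dist_commute norm_scaleR abs_of_nonneg divide_inverse mult.commute
          inverse_nonnegative_iff_nonnegative of_nat_0_le_iff mult.left_neutral)
    also have "\<dots> \<le> B / real N" using B[OF that] by (simp add: divide_right_mono)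
    also have "\<dots> < \<delta> / 2" using N N0 by (simp add: field_simps)
    finally show ?thesis .
  qed
  have side: "dist (pt x i) (pt y i) < \<delta> / 2" if "dist x y < \<delta> / 2" "i \<le> N" for x y i
  proof -
    have "pt x i - pt y i = (real i / real N) *\<^sub>R (x - y)" by (simp add: pt_def algebra_simps)
    then have "dist (pt x i) (pt y i) = (real i / real N) * dist x y" by (simp add: dist_norm)
    also have "\<dots> \<le> 1 * dist x y" using that(2) N0 by (intro mult_right_mono) auto
    finally show ?thesis using that(1) by simp
  qed
  define \<psi> where "\<psi> x i = (\<Sum>j<i. C (pt x j) (pt x (Suc j)))" for x i
  have ladder: "\<psi> x i + C (pt x i) (pt y i) = \<psi> y i"
    if x: "x \<in> S" and y: "y \<in> S" and d: "dist x y < \<delta> / 2" and "i \<le> N" for x y i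
    using \<open>i \<le> N\<close>
  proof (induction i)
    case 0
    show ?case using local_cocycle_diag[OF C a] by (simp add: \<psi>_def pt_def)
  next
    case (Suc i)
    note S = ptS[OF x, of i] ptS[OF x, of "Suc i"] ptS[OF y, of i] ptS[OF y, of "Suc i"]
    note ds = step[OF x, of i] step[OF y, of i] side[OF d, of i] side[OF d, of "Suc i"]
    have diag: "dist (pt x i) (pt y (Suc i)) < \<delta>"
      using ds(2,3) Suc.prems dist_triangle[of "pt x i" "pt y (Suc i)" "pt y i"] by auto
    have 1: "C (pt x i) (pt x (Suc i)) + C (pt x (Suc i)) (pt y (Suc i)) = C (pt x i) (pt y (Suc i))"
      using S ds diag Suc.prems C(2) by (intro local_cocycleD[OF C(1)]) auto
    have 2: "C (pt x i) (pt y i) + C (pt y i) (pt y (Suc i)) = C (pt x i) (pt y (Suc i))"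
      using S ds diag Suc.prems C(2) by (intro local_cocycleD[OF C(1)]) auto
    have "\<psi> x (Suc i) + C (pt x (Suc i)) (pt y (Suc i))
        = \<psi> x i + (C (pt x i) (pt x (Suc i)) + C (pt x (Suc i)) (pt y (Suc i)))"
      by (simp add: \<psi>_def add.assoc)
    also have "\<dots> = (\<psi> x i + C (pt x i) (pt y i)) + C (pt y i) (pt y (Suc i))"
      by (simp only: 1 2[symmetric] add.assoc)
    also have "\<dots> = \<psi> y (Suc i)" using Suc by (simp add: \<psi>_def)
    finally show ?case .
  qed
  have "pt x N = x" for x using N0 by (simp add: pt_def)
  then have "C x y = \<psi> y N - \<psi> x N" if "x \<in> S" "y \<in> S" "dist x y < \<delta> / 2" for x y
    using ladder[OF that order_refl] by (metis add_diff_cancel_left')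
  then show thesis using that[of "\<delta> / 2"] C(2) by auto
qed

text \<open>The sum of the cocycle over a fine subdivision of the path, encoded by a potential on
  the unit interval so that no subdivision is mentioned.\<close>

definition increment_along :: "('m \<Rightarrow> 'm \<Rightarrow> 'g::ab_group_add) \<Rightarrow> (real \<Rightarrow> 'm) \<Rightarrow> 'g \<Rightarrow> bool" where
  "increment_along C p d \<longleftrightarrow> (\<exists>\<phi> \<epsilon>. \<epsilon> > 0 \<and>
     (\<forall>s\<in>{0..1}. \<forall>t\<in>{0..1}. dist s t < \<epsilon> \<longrightarrow> C (p s) (p t) = \<phi> t - \<phi> s) \<and> d = \<phi> 1 - \<phi> 0)"

lemma increment_along_exists:
  assumes "local_cocycle \<delta> S C" "\<delta> > 0" "path p" "path_image p \<subseteq> S"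
  obtains d where "increment_along C p d"
proof -
  obtain \<epsilon> where e: "\<epsilon> > 0" "local_cocycle \<epsilon> {0..1} (\<lambda>x y. C (p x) (p y))"
    using local_cocycle_pullback[OF assms(1,2), of "{0..1}" p] assms(3,4)
    unfolding path_def path_image_def by blast
  obtain \<phi> \<eta> where "\<eta> > 0"
    "\<And>x y. x \<in> {0..1} \<Longrightarrow> y \<in> {0..1} \<Longrightarrow> dist x y < \<eta> \<Longrightarrow> C (p x) (p y) = \<phi> y - \<phi> x"
    using local_cocycle_convex_exact[OF convex_real_interval(5) bounded_closed_interval e(2,1)] by metis
  then show thesis using that unfolding increment_along_def by blast
qed

text \<open>On the square of the homotopy the pulled-back cocycle has a potential, the square being
  convex. Its increments along two opposite sides are \<open>d\<close> and \<open>e\<close>; on the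
  other two sides the homotopy is constant and the cocycle vanishes on the diagonal. Taking
  \<open>p\<close> equal to \<open>q\<close> gives uniqueness of the increment.\<close>

lemma increment_along_homotopic:
  fixes C :: "'m::real_normed_vector \<Rightarrow> 'm \<Rightarrow> 'g::ab_group_add"
  assumes C: "local_cocycle \<delta> S C" "\<delta> > 0" and "homotopic_paths S p q"
    and p: "increment_along C p d" and q: "increment_along C q e"
  shows "d = e"
proof -
  obtain h :: "real \<times> real \<Rightarrow> 'm" where h: "continuous_on ({0..1} \<times> {0..1}) h"
      "h ` ({0..1} \<times> {0..1}) \<subseteq> S"
      "\<And>t. t \<in> {0..1} \<Longrightarrow> h (0, t) = p t" "\<And>t. t \<in> {0..1} \<Longrightarrow> h (1, t) = q t"
      "\<And>s. s \<in> {0..1} \<Longrightarrow> h (s, 0) = pathstart p" "\<And>s. s \<in> {0..1} \<Longrightarrow> h (s, 1) = pathfinish p"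
  proof -
    obtain h :: "real \<times> real \<Rightarrow> 'm" where h: "continuous_on ({0..1} \<times> {0..1}) h" "h \<in> ({0..1} \<times> {0..1}) \<rightarrow> S"
      "\<forall>t\<in>{0..1}. h (0, t) = p t" "\<forall>t\<in>{0..1}. h (1, t) = q t"
      "\<forall>s\<in>{0..1}. pathstart (h \<circ> Pair s) = pathstart p \<and> pathfinish (h \<circ> Pair s) = pathfinish p"
      using assms(3) unfolding homotopic_paths by blast
    show thesis
      by (rule that[OF h(1)]) (use h(2-5) in \<open>auto simp: pathstart_def pathfinish_def\<close>)
  qed
  obtain \<epsilon> where e: "\<epsilon> > 0" "local_cocycle \<epsilon> ({0..1} \<times> {0..1}) (\<lambda>x y. C (h x) (h y))"
    using local_cocycle_pullback[OF C h(1) _ h(2)] by (auto simp: compact_Times)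
  obtain \<phi> \<eta> where eta: "\<eta> > 0" and phi: "\<And>x y. x \<in> {0..1} \<times> {0..1} \<Longrightarrow> y \<in> {0..1} \<times> {0..1}
      \<Longrightarrow> dist x y < \<eta> \<Longrightarrow> C (h x) (h y) = \<phi> y - \<phi> x"
    using local_cocycle_convex_exact[OF
        convex_Times[OF convex_real_interval(5) convex_real_interval(5)]
        bounded_Times[OF bounded_closed_interval bounded_closed_interval] e(2,1)] by metis
  have side: "d' = \<phi> (a, 1) - \<phi> (a, 0)"
    if r: "increment_along C r d'" and a: "a \<in> {0..1}" "\<And>t. t \<in> {0..1} \<Longrightarrow> h (a, t) = r t" for r a d'
  proof -
    obtain \<psi> \<zeta> where z: "\<zeta> > 0" "d' = \<psi> 1 - \<psi> 0"
      and psi: "\<And>s t. s \<in> {0..1} \<Longrightarrow> t \<in> {0..1} \<Longrightarrow> dist s t < \<zeta> \<Longrightarrow> C (r s) (r t) = \<psi> t - \<psi> s"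
      using r unfolding increment_along_def by blast
    \<comment> \<open>Two potentials of the same cocycle differ by a locally constant
      function.\<close>
    have "\<phi> (a, 0) - \<psi> 0 = \<phi> (a, 1) - \<psi> 1"
    proof (rule locally_constant_on_connected[of "{0..1}" "min \<zeta> \<eta>" "\<lambda>t. \<phi> (a, t) - \<psi> t"])
      fix s t :: real assume st: "s \<in> {0..1}" "t \<in> {0..1}" "dist s t < min \<zeta> \<eta>"
      have "C (r s) (r t) = \<phi> (a, t) - \<phi> (a, s)"
        using phi[of "(a, s)" "(a, t)"] st a by (simp add: dist_Pair_Pair)
      with psi[of s t] st show "\<phi> (a, s) - \<psi> s = \<phi> (a, t) - \<psi> t" by (simp add: algebra_simps)
    qed (use z eta in auto)
    then have "\<phi> (a, 1) = \<psi> 1 + (\<phi> (a, 0) - \<psi> 0)" by (metis add.commute diff_add_cancel)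
    then show ?thesis using z(2) by simp
  qed
  have "pathstart p \<in> S" "pathfinish p \<in> S"
  proof -
    have "h (0, 0) \<in> S" "h (0, 1) \<in> S" using h(2) by auto
    then show "pathstart p \<in> S" "pathfinish p \<in> S" using h(5,6)[of 0] by auto
  qed
  then have diag: "C (pathstart p) (pathstart p) = 0" "C (pathfinish p) (pathfinish p) = 0"
    using local_cocycle_diag[OF C] by auto
  have "\<phi> (0, 0) = \<phi> (1, 0)"
  proof (rule locally_constant_on_connected[of "{0..1}" \<eta> "\<lambda>s. \<phi> (s, 0)"])
    fix s t :: real assume "s \<in> {0..1}" "t \<in> {0..1}" "dist s t < \<eta>"
    then show "\<phi> (s, 0) = \<phi> (t, 0)"
      using phi[of "(s, 0)" "(t, 0)"] diag(1) by (simp add: dist_Pair_Pair h(5))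
  qed (use eta in auto)
  moreover have "\<phi> (0, 1) = \<phi> (1, 1)"
  proof (rule locally_constant_on_connected[of "{0..1}" \<eta> "\<lambda>s. \<phi> (s, 1)"])
    fix s t :: real assume "s \<in> {0..1}" "t \<in> {0..1}" "dist s t < \<eta>"
    then show "\<phi> (s, 1) = \<phi> (t, 1)"
      using phi[of "(s, 1)" "(t, 1)"] diag(2) by (simp add: dist_Pair_Pair h(6))
  qed (use eta in auto)
  ultimately show ?thesis using side[OF p _ h(3)] side[OF q _ h(4)] by simp
qed

text \<open>A potential along the joined path, read on its two halves and rescaled, is a potential
  along each piece; uniqueness identifies the increments.\<close>

lemma increment_along_join:
  fixes C :: "'m::real_normed_vector \<Rightarrow> 'm \<Rightarrow> 'g::ab_group_add"
  assumes "increment_along C p d" "increment_along C q e" "increment_along C (p +++ q) f"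
    and "local_cocycle \<delta> S C" "\<delta> > 0" "path p" "path q" "path_image p \<subseteq> S" "path_image q \<subseteq> S"
    and fin: "pathfinish p = pathstart q"
  shows "f = d + e"
proof -
  obtain \<phi> \<epsilon> where e: "\<epsilon> > 0" "f = \<phi> 1 - \<phi> 0"
    and phi: "\<And>s t. s \<in> {0..1} \<Longrightarrow> t \<in> {0..1} \<Longrightarrow> dist s t < \<epsilon> \<Longrightarrow> C ((p +++ q) s) ((p +++ q) t) = \<phi> t - \<phi> s"
    using assms(3) unfolding increment_along_def by blast
  have 1: "(p +++ q) (t / 2) = p t" if "t \<in> {0..1}" for t using that by (simp add: joinpaths_def)
  have 2: "(p +++ q) ((t + 1) / 2) = q t" if "t \<in> {0..1}" for t
    using that fin by (cases "t = 0") (auto simp: joinpaths_def pathfinish_def pathstart_def field_simps)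
  have p': "increment_along C p (\<phi> (1 / 2) - \<phi> 0)"
    unfolding increment_along_def
  proof (intro exI[of _ "\<lambda>t. \<phi> (t / 2)"] exI[of _ \<epsilon>] conjI ballI impI)
    fix s t :: real assume "s \<in> {0..1}" "t \<in> {0..1}" "dist s t < \<epsilon>"
    then show "C (p s) (p t) = \<phi> (t / 2) - \<phi> (s / 2)"
      using phi[of "s / 2" "t / 2"] by (simp add: 1 dist_real_def)
  qed (use e in auto)
  have q': "increment_along C q (\<phi> 1 - \<phi> (1 / 2))"
    unfolding increment_along_def
  proof (intro exI[of _ "\<lambda>t. \<phi> ((t + 1) / 2)"] exI[of _ \<epsilon>] conjI ballI impI)
    fix s t :: real assume st: "s \<in> {0..1}" "t \<in> {0..1}" "dist s t < \<epsilon>"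
    have d: "dist ((s + 1) / 2) ((t + 1) / 2) < \<epsilon>" using st(3) e(1) unfolding dist_real_def abs_less_iff by (auto simp: field_simps)
    show "C (q s) (q t) = \<phi> ((t + 1) / 2) - \<phi> ((s + 1) / 2)"
      unfolding 2[OF st(1), symmetric] 2[OF st(2), symmetric]
      using st d by (intro phi) auto
  qed (use e in auto)
  have "d = \<phi> (1 / 2) - \<phi> 0"
    by (rule increment_along_homotopic[OF assms(4,5) _ assms(1) p']) (simp add: assms)
  moreover have "e = \<phi> 1 - \<phi> (1 / 2)"
    by (rule increment_along_homotopic[OF assms(4,5) _ assms(2) q']) (simp add: assms)
  ultimately show ?thesis using e(2) by simp
qed

section \<open>Simplicial cocycles\<close>

lemma simplicial_complexD:
  assumes "simplicial_complex K"
  shows "finite K" "\<And>S. S \<in> K \<Longrightarrow> \<exists>n. n simplex S"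
    "\<And>F S. S \<in> K \<Longrightarrow> F face_of S \<Longrightarrow> F \<in> K"
    "\<And>S T. S \<in> K \<Longrightarrow> T \<in> K \<Longrightarrow> S \<inter> T face_of S"
    "\<And>S. S \<in> K \<Longrightarrow> convex S" "\<And>S. S \<in> K \<Longrightarrow> compact S"
  using assms unfolding simplicial_complex_def by (auto intro: convex_simplex compact_simplex)

text \<open>A Lebesgue number of the cover by open stars: all points near \<open>x\<close> lie in the open star
  of the vertex \<open>\<nu> x\<close>, so the vertices chosen for nearby points span a simplex.\<close>

lemma simplicial_complex_star_choice:
  fixes K :: "'a::euclidean_space set set"
  assumes K: "simplicial_complex K"
  obtains \<delta> \<nu> where "\<delta> > 0" "\<And>x. x \<in> \<Union>K \<Longrightarrow> {\<nu> x} \<in> K"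
    "\<And>x y T. x \<in> \<Union>K \<Longrightarrow> T \<in> K \<Longrightarrow> y \<in> T \<Longrightarrow> dist x y < \<delta> \<Longrightarrow> \<nu> x \<in> T"
proof (cases "\<Union>K = {}")
  case True
  then show thesis by (intro that[of 1 "\<lambda>_. undefined"]) auto
next
  case False
  note K' = simplicial_complexD[OF K]
  define star where "star v = - \<Union>{T \<in> K. v \<notin> T}" for v
  have cover: "\<exists>v. {v} \<in> K \<and> x \<in> star v" if x: "x \<in> \<Union>K" for x
  proof -
    have "finite {S \<in> K. x \<in> S}" "{S \<in> K. x \<in> S} \<noteq> {}" using K'(1) x by auto
    then obtain S where S: "S \<in> K" "x \<in> S" and min: "\<And>T. T \<in> K \<Longrightarrow> x \<in> T \<Longrightarrow> T \<subseteq> S \<Longrightarrow> T = S"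
      using finite_has_minimal[of "{S \<in> K. x \<in> S}"] by blast
    obtain v where v: "v extreme_point_of S"
      using extreme_point_exists_convex[of S] K'(5,6)[OF S(1)] S(2) by blast
    have "v \<in> T" if T: "T \<in> K" "x \<in> T" for T
    proof -
      have "S \<inter> T \<in> K" using K'(3)[OF S(1) K'(4)[OF S(1) T(1)]] .
      then have "S \<inter> T = S" using min S T by blast
      then show ?thesis using v unfolding extreme_point_of_def by blast
    qed
    moreover have "{v} \<in> K" using K'(3)[OF S(1)] v by (simp add: face_of_singleton)
    ultimately show ?thesis unfolding star_def by blast
  qed
  have "open (star v)" for v
    unfolding star_def using K'(1,6) by (intro open_Compl closed_Union) (auto intro: compact_imp_closed)
  moreover have "compact (\<Union>K)" using K'(1,6) by (rule compact_Union)
  moreover have "star ` {v. {v} \<in> K} \<noteq> {}" using cover False by auto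
  moreover have "\<Union>K \<subseteq> \<Union>(star ` {v. {v} \<in> K})" using cover by blast
  ultimately obtain \<delta> where d: "\<delta> > 0"
    "\<And>T. T \<subseteq> \<Union>K \<Longrightarrow> diameter T < \<delta> \<Longrightarrow> \<exists>B\<in>star ` {v. {v} \<in> K}. T \<subseteq> B"
    using Lebesgue_number_lemma[of "\<Union>K" "star ` {v. {v} \<in> K}"] by (metis (no_types, lifting) imageE)
  \<comment> \<open>A ball of radius \<delta>/3 has diameter below the Lebesgue number
    \<delta>.\<close>
  have "\<exists>v. {v} \<in> K \<and> (\<forall>y\<in>\<Union>K. dist x y < \<delta> / 3 \<longrightarrow> y \<in> star v)" for x
  proof -
    have "diameter (ball x (\<delta> / 3) \<inter> \<Union>K) \<le> diameter (ball x (\<delta> / 3))"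
      by (intro diameter_subset) auto
    also have "\<dots> < \<delta>" using d(1) by simp
    finally obtain v where v: "{v} \<in> K" "ball x (\<delta> / 3) \<inter> \<Union>K \<subseteq> star v"
      using d(2)[of "ball x (\<delta> / 3) \<inter> \<Union>K"] by auto
    have "y \<in> star v" if "y \<in> \<Union>K" "dist x y < \<delta> / 3" for y
      using v(2) that by (meson IntI mem_ball subsetD)
    then show ?thesis using v(1) by blast
  qed
  then obtain \<nu> where "\<And>x. {\<nu> x} \<in> K"
    and "\<And>x y. y \<in> \<Union>K \<Longrightarrow> dist x y < \<delta> / 3 \<Longrightarrow> y \<in> star (\<nu> x)" by metis
  then show thesis using that[of "\<delta> / 3" \<nu>] d(1) unfolding star_def by fastforce
qed

text \<open>Points \<delta>-close to \<open>y\<close> have their chosen vertices in every simplex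
  through \<open>y\<close>, so \<open>C\<close> is a local cocycle. Summing it along paths from a
  base point gives \<open>h\<close>, independent of the path because the space is simply connected.
  A vertex is its own choice, so \<open>C\<close> agrees with \<open>c\<close> on vertices.\<close>

lemma simplicial_cocycle_exact:
  fixes K :: "'a::euclidean_space set set" and c :: "'a \<Rightarrow> 'a \<Rightarrow> 'g::ab_group_add"
  assumes K: "simplicial_complex K" and sc: "simply_connected (\<Union>K)"
    and c: "\<And>T u v w. T \<in> K \<Longrightarrow> u \<in> T \<Longrightarrow> v \<in> T \<Longrightarrow> w \<in> T \<Longrightarrow> {u} \<in> K \<Longrightarrow> {v} \<in> K \<Longrightarrow> {w} \<in> K
      \<Longrightarrow> c u v + c v w = c u w"
  obtains h where
    "\<And>T u v. T \<in> K \<Longrightarrow> u \<in> T \<Longrightarrow> v \<in> T \<Longrightarrow> {u} \<in> K \<Longrightarrow> {v} \<in> K \<Longrightarrow> c u v = h v - h u"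
proof (cases "\<Union>K = {}")
  case True
  then show thesis by (intro that[of "\<lambda>_. 0"]) auto
next
  case False
  then obtain a where a: "a \<in> \<Union>K" by blast
  obtain \<delta> \<nu> where d: "\<delta> > 0" and nu: "\<And>x. x \<in> \<Union>K \<Longrightarrow> {\<nu> x} \<in> K"
    and star: "\<And>x y T. x \<in> \<Union>K \<Longrightarrow> T \<in> K \<Longrightarrow> y \<in> T \<Longrightarrow> dist x y < \<delta> \<Longrightarrow> \<nu> x \<in> T"
    using simplicial_complex_star_choice[OF K] by blast
  have own: "\<nu> x \<in> T" if "T \<in> K" "x \<in> T" for x T
    using star[of x T x] that d by auto
  define C where "C x y = c (\<nu> x) (\<nu> y)" for x y
  have C: "local_cocycle \<delta> (\<Union>K) C"
    unfolding local_cocycle_def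
  proof (intro ballI impI)
    fix x y z assume xyz: "x \<in> \<Union>K" "y \<in> \<Union>K" "z \<in> \<Union>K" "dist x y < \<delta> \<and> dist y z < \<delta> \<and> dist x z < \<delta>"
    then obtain T where T: "T \<in> K" "y \<in> T" by blast
    have "\<nu> x \<in> T" "\<nu> y \<in> T" "\<nu> z \<in> T"
      using star[of _ T y] T xyz d by (auto simp: dist_commute)
    then show "C x y + C y z = C x z" unfolding C_def using T nu xyz by (intro c[of T]) auto
  qed
  have pc: "path_connected (\<Union>K)" using sc by (rule simply_connected_imp_path_connected)
  have "\<exists>g. path g \<and> path_image g \<subseteq> \<Union>K \<and> pathstart g = a \<and> pathfinish g = x" if "x \<in> \<Union>K" for x
    using pc a that unfolding path_connected_def by blast
  then obtain \<gamma> where g: "\<And>x. x \<in> \<Union>K \<Longrightarrow> path (\<gamma> x) \<and> path_image (\<gamma> x) \<subseteq> \<Union>K \<and>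
      pathstart (\<gamma> x) = a \<and> pathfinish (\<gamma> x) = x" by metis
  have "\<exists>d. increment_along C (\<gamma> x) d" if "x \<in> \<Union>K" for x
    using increment_along_exists[OF C d] g[OF that] by metis
  then obtain h where h: "\<And>x. x \<in> \<Union>K \<Longrightarrow> increment_along C (\<gamma> x) (h x)" by metis
  have "c u v = h v - h u"
    if T: "T \<in> K" "u \<in> T" "v \<in> T" and uv: "{u} \<in> K" "{v} \<in> K" for T u v
  proof -
    have UV: "u \<in> \<Union>K" "v \<in> \<Union>K" using T by auto
    have "closed_segment u v \<subseteq> T"
      using simplicial_complexD(5)[OF K T(1)] T(2,3) by (simp add: closed_segment_subset)
    then have seg: "path_image (linepath u v) \<subseteq> T" by simp
    have lT: "linepath u v t \<in> T" if "t \<in> {0..1}" for t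
      using seg that unfolding path_image_def by blast
    have nuv: "\<nu> u = u" "\<nu> v = v" using own uv by blast+
    \<comment> \<open>Inside one simplex the cocycle rule holds without any bound on distances,
      which provides this potential; the scale 1 is arbitrary.\<close>
    have "increment_along C (linepath u v) (c u v)"
      unfolding increment_along_def
    proof (intro exI[of _ "\<lambda>t. c u (\<nu> (linepath u v t))"] exI[of _ 1] conjI ballI impI)
      fix s t :: real assume st: "s \<in> {0..1}" "t \<in> {0..1}"
      have "\<nu> (linepath u v s) \<in> T" "\<nu> (linepath u v t) \<in> T" using own lT st T(1) by blast+
      then have "c u (\<nu> (linepath u v s)) + C (linepath u v s) (linepath u v t) = c u (\<nu> (linepath u v t))"
        unfolding C_def using T uv nu lT st by (intro c[of T]) auto
      then show "C (linepath u v s) (linepath u v t) = c u (\<nu> (linepath u v t)) - c u (\<nu> (linepath u v s))"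
        by (simp add: algebra_simps)
    next
      have "c u u = 0" using c[OF T(1) T(2) T(2) T(2)] uv by simp
      then show "c u v = c u (\<nu> (linepath u v 1)) - c u (\<nu> (linepath u v 0))"
        by (simp add: linepath_0' linepath_1' nuv)
    qed simp
    moreover obtain f where f: "increment_along C (\<gamma> u +++ linepath u v) f"
      using increment_along_exists[OF C d, of "\<gamma> u +++ linepath u v"] g[OF UV(1)] seg T(1)
      by (metis Sup_upper path_join_imp path_linepath pathstart_linepath subset_path_image_join subset_trans)
    ultimately have "f = h u + c u v"
      using g[OF UV(1)] seg T(1) by (intro increment_along_join[OF h[OF UV(1)] _ f C d]) auto
    moreover have "homotopic_paths (\<Union>K) (\<gamma> u +++ linepath u v) (\<gamma> v)"
    proof -
      have "path_image (\<gamma> u +++ linepath u v) \<subseteq> \<Union>K"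
        using g[OF UV(1)] seg T(1) by (intro subset_path_image_join) auto
      then show ?thesis
        using sc g[OF UV(1)] g[OF UV(2)] unfolding simply_connected_eq_homotopic_paths
        by (auto simp: path_join_imp)
    qed
    ultimately show ?thesis
      using increment_along_homotopic[OF C d _ f h[OF UV(2)]] by (simp add: algebra_simps)
  qed
  then show thesis using that by blast
qed

lemma simplicial_locally_constant:
  fixes K :: "'a::euclidean_space set set"
  assumes K: "simplicial_complex K" and con: "connected (\<Union>K)"
    and f: "\<And>T u v. T \<in> K \<Longrightarrow> u \<in> T \<Longrightarrow> v \<in> T \<Longrightarrow> {u} \<in> K \<Longrightarrow> {v} \<in> K \<Longrightarrow> f u = f v"
    and uv: "{u} \<in> K" "{v} \<in> K"
  shows "f u = f v"
proof -
  obtain \<delta> \<nu> where d: "\<delta> > 0" and nu: "\<And>x. x \<in> \<Union>K \<Longrightarrow> {\<nu> x} \<in> K"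
    and star: "\<And>x y T. x \<in> \<Union>K \<Longrightarrow> T \<in> K \<Longrightarrow> y \<in> T \<Longrightarrow> dist x y < \<delta> \<Longrightarrow> \<nu> x \<in> T"
    using simplicial_complex_star_choice[OF K] by blast
  have "f (\<nu> u) = f (\<nu> v)"
  proof (rule locally_constant_on_connected[OF con d, of "\<lambda>x. f (\<nu> x)"])
    fix x y assume xy: "x \<in> \<Union>K" "y \<in> \<Union>K" "dist x y < \<delta>"
    then obtain T where "T \<in> K" "y \<in> T" by blast
    then show "f (\<nu> x) = f (\<nu> y)" using star[of x T y] star[of y T y] xy nu d by (intro f[of T]) auto
  qed (use uv in auto)
  moreover have "\<nu> u = u" "\<nu> v = v" using star[of u "{u}" u] star[of v "{v}" v] uv d by auto
  ultimately show ?thesis by simp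
qed

section \<open>Edges of an even triangulation\<close>

text \<open>Three notions of vertex agree: generator of the hull, zero-dimensional simplex of
  \<open>K\<close> inside \<open>S\<close>, and extreme point. The second gives the third because
  two simplices of \<open>K\<close> meet in a face.\<close>

lemma simplex_vertices:
  assumes K: "simplicial_complex K" and S: "S \<in> K"
  obtains C where "\<not> affine_dependent C" "finite C" "S = convex hull C"
    "C = {x \<in> S. {x} \<in> K}" "C = {x. x extreme_point_of S}"
proof -
  note K' = simplicial_complexD[OF K]
  obtain n where "n simplex S" using K'(2)[OF S] by blast
  then obtain C where C: "finite C" "\<not> affine_dependent C" "S = convex hull C"
    unfolding simplex by blast
  have ext: "x extreme_point_of S \<longleftrightarrow> x \<in> C" for x
    using extreme_point_of_convex_hull_affine_independent[OF C(2)] C(3) by simp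
  have "x extreme_point_of S \<longleftrightarrow> x \<in> S \<and> {x} \<in> K" for x
  proof
    assume "x extreme_point_of S"
    then show "x \<in> S \<and> {x} \<in> K"
      using K'(3)[OF S] by (auto simp: face_of_singleton extreme_point_of_def)
  next
    assume x: "x \<in> S \<and> {x} \<in> K"
    then have "S \<inter> {x} = {x}" by auto
    then have "{x} face_of S" using K'(4)[OF S, of "{x}"] x by simp
    then show "x extreme_point_of S" by (simp add: face_of_singleton)
  qed
  then have "C = {x \<in> S. {x} \<in> K}" "C = {x. x extreme_point_of S}" using ext by auto
  then show thesis using that C by blast
qed

lemma simplex_sub_hull:
  assumes K: "simplicial_complex K" and S: "S \<in> K" and A: "A \<subseteq> {x \<in> S. {x} \<in> K}"
  shows "convex hull A \<in> K" "finite A" "(int (card A) - 1) simplex (convex hull A)"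
    "x extreme_point_of (convex hull A) \<longleftrightarrow> x \<in> A"
proof -
  obtain C where C: "\<not> affine_dependent C" "finite C" "S = convex hull C" "C = {x \<in> S. {x} \<in> K}"
      "C = {x. x extreme_point_of S}"
    by (rule simplex_vertices[OF K S])
  have AC: "A \<subseteq> C" using A by (subst C(4))
  have ind: "\<not> affine_dependent A" using AC C(1) affine_dependent_subset by blast
  have "convex hull A face_of S"
    using face_of_convex_hull_affine_independent[OF C(1)] AC C(3) by blast
  then show "convex hull A \<in> K" using simplicial_complexD(3)[OF K S] by blast
  show "finite A" using AC C(2) finite_subset by blast
  then show "(int (card A) - 1) simplex (convex hull A)" using ind unfolding simplex by auto
  show "x extreme_point_of (convex hull A) \<longleftrightarrow> x \<in> A"
    by (rule extreme_point_of_convex_hull_affine_independent[OF ind])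
qed

text \<open>Serves to embed an edge in the real axis of the complex plane.\<close>

lemma inj_on_dist_closed_segment:
  fixes a b :: "'a::euclidean_space"
  shows "inj_on (dist a) (closed_segment a b)"
proof (rule inj_onI)
  fix x y assume "x \<in> closed_segment a b" "y \<in> closed_segment a b" and d: "dist a x = dist a y"
  then obtain s t where st: "s \<ge> 0" "x = (1 - s) *\<^sub>R a + s *\<^sub>R b" "t \<ge> 0" "y = (1 - t) *\<^sub>R a + t *\<^sub>R b"
    unfolding closed_segment_def by blast
  have "a - x = s *\<^sub>R (a - b)" "a - y = t *\<^sub>R (a - b)" using st by (auto simp: algebra_simps)
  then have "s * norm (a - b) = t * norm (a - b)" using d st by (simp add: dist_norm)
  then show "x = y" using st by auto
qed

text \<open>Otherwise some neighbourhood of a relative interior point of the edge would be contained in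
  the edge or in a single triangle of which the edge is a side, against invariance of domain.\<close>

lemma sphere_edge_in_two_triangles:
  fixes K :: "'a::euclidean_space set set"
  assumes K: "simplicial_complex K" and sph: "\<Union>K homeomorphic (sphere 0 1 :: (real ^ 3) set)"
    and dim: "\<And>S n. S \<in> K \<Longrightarrow> n simplex S \<Longrightarrow> n \<le> 2"
    and E: "E \<in> K" "1 simplex E"
  obtains T where "T \<in> triangles K" "E \<subseteq> T" "T \<noteq> T0"
proof (rule ccontr)
  assume "\<not> thesis"
  then have only: "\<And>T. T \<in> triangles K \<Longrightarrow> E \<subseteq> T \<Longrightarrow> T = T0" using that by blast
  note K' = simplicial_complexD[OF K]
  obtain a b where ab: "a \<noteq> b" "E = closed_segment a b" 
  proof -
    obtain C where C: "card C = 2" "E = convex hull C" using E(2) unfolding simplex by auto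
    then obtain a b where "C = {a, b}" "a \<noteq> b" by (auto simp: card_2_iff)
    then show thesis using that C(2) by (simp add: segment_convex_hull)
  qed
  obtain x where x: "x \<in> rel_interior E"
    using rel_interior_eq_empty[of E] ab by auto
  \<comment> \<open>The open star of \<open>E\<close>, an open piece of the surface made up of
    simplices that contain \<open>E\<close>.\<close>
  define U where "U = \<Union>K - \<Union>{T \<in> K. \<not> E \<subseteq> T}"
  have xE: "x \<in> E" using x rel_interior_subset by blast
  have "E \<subseteq> T" if "T \<in> K" "x \<in> T" for T
  proof -
    have "E \<inter> T face_of E" using K'(4) E that by blast
    moreover have "x \<in> (E \<inter> T) \<inter> rel_interior E" using x xE that by blast
    ultimately have "E \<inter> T = E" using face_of_disjoint_rel_interior by blast
    then show ?thesis by blast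
  qed
  then have xU: "x \<in> U" unfolding U_def using xE E by blast
  have "closed (\<Union>{T \<in> K. \<not> E \<subseteq> T})" using K'(1,6) by (intro closed_Union) (auto intro: compact_imp_closed)
  then have opU: "openin (top_of_set (\<Union>K)) U"
    unfolding U_def by (simp add: Diff_eq openin_open_Int open_Compl)
  have cases: "S = E \<or> S = T0 \<and> S \<in> triangles K" if S: "S \<in> K" "E \<subseteq> S" for S
  proof -
    obtain n where n: "n simplex S" using K'(2) S by blast
    have "aff_dim E \<le> aff_dim S" using S aff_dim_subset by blast
    then have "n = 1 \<or> n = 2" using dim[OF S(1) n] aff_dim_simplex[OF n] aff_dim_simplex[OF E(2)] by auto
    then show ?thesis
    proof
      assume "n = 1"
      then have "aff_dim E = aff_dim S" using aff_dim_simplex n E(2) by metis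
      moreover have "E face_of S" using K'(4)[OF S(1) E(1)] S by (simp add: Int_absorb1)
      ultimately have "E = S"
        using face_of_aff_dim_lt[of S E] K'(5)[OF S(1)] by (metis less_irrefl)
      then show ?thesis by simp
    next
      assume "n = 2"
      then have "S \<in> triangles K" using n S by (simp add: triangles_def)
      then show ?thesis using only S by blast
    qed
  qed
  obtain f g where fg: "homeomorphism (\<Union>K) (sphere 0 1 :: (real ^ 3) set) f g"
    using sph unfolding homeomorphic_def by blast
  define S where "S = f ` U"
  have opS: "openin (top_of_set (sphere 0 1 :: (real ^ 3) set)) S"
    unfolding S_def by (rule homeomorphism_imp_open_map[OF fg opU])
  have UK: "U \<subseteq> \<Union>K" by (auto simp: U_def)
  have "g (f y) = y" if "y \<in> U" for y using homeomorphism_apply1[OF fg] UK that by blast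
  then have gS: "g ` S = U" unfolding S_def by (simp add: image_image)
  have SS: "S \<subseteq> sphere 0 1" using opS openin_imp_subset by blast
  have cg: "continuous_on S g" 
    by (rule continuous_on_subset[OF homeomorphism_cont2[OF fg] SS])
  have ig: "inj_on g S"
    by (rule inj_on_inverseI[of _ f]) (use homeomorphism_apply2[OF fg] SS in blast)
  show False
  proof (cases "T0 \<in> triangles K \<and> E \<subseteq> T0")
    case True
    then have T0: "T0 \<in> K" "2 simplex T0" by (auto simp: triangles_def)
    have UT: "U \<subseteq> T0" using cases True unfolding U_def by blast
    \<comment> \<open>Surface and plane of \<open>T0\<close> both have dimension two, so the open
      star is open in that plane, and \<open>x\<close> would be interior to a triangle although it
      lies on a side.\<close>
    have "openin (top_of_set (affine hull T0)) (g ` S)"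
    proof (rule invariance_of_domain_sphere_affine_set[OF cg ig _ _ _ _ opS])
      show "g \<in> S \<rightarrow> affine hull T0" using gS UT hull_subset[of T0 affine] by blast
      show "aff_dim (affine hull T0) < int (DIM(real ^ 3))" using aff_dim_simplex[OF T0(2)] by simp
    qed auto
    then have "x \<in> rel_interior T0" using xU gS UT unfolding rel_interior_def by blast
    moreover have "E face_of T0" using K'(4)[OF T0(1) E(1)] True by (simp add: Int_absorb1)
    moreover have "E \<noteq> T0" using aff_dim_simplex[OF T0(2)] aff_dim_simplex[OF E(2)] by auto
    ultimately show False using face_of_disjoint_rel_interior xE by blast
  next
    case False
    then have UE: "U \<subseteq> E" using cases unfolding U_def by blast
    \<comment> \<open>Here the open star is contained in the edge. Its image in the complex plane
      would be open by invariance of domain, yet it consists of real numbers.\<close>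
    define \<phi> where "\<phi> y = complex_of_real (dist a y)" for y
    have ip: "inj_on \<phi> E" using inj_on_dist_closed_segment[of a b] ab unfolding \<phi>_def inj_on_def by auto
    have "openin (top_of_set (UNIV :: complex set)) ((\<phi> \<circ> g) ` S)"
    proof (rule invariance_of_domain_sphere_affine_set[OF _ _ _ _ _ _ opS])
      show "continuous_on S (\<phi> \<circ> g)"
        unfolding \<phi>_def comp_def by (intro continuous_intros cg)
      show "inj_on (\<phi> \<circ> g) S" using ig ip gS UE by (intro comp_inj_on) (auto intro: inj_on_subset)
      show "aff_dim (UNIV :: complex set) < int (DIM(real ^ 3))" by simp
    qed auto
    then have "open (\<phi> ` U)" unfolding gS[symmetric] by (simp add: image_comp)
    then obtain e where "e > 0" "ball (\<phi> x) e \<subseteq> \<phi> ` U" using xU unfolding open_contains_ball by blast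
    then have "\<phi> x + \<i> * complex_of_real (e / 2) \<in> \<phi> ` U"
      by (intro subsetD[OF \<open>ball (\<phi> x) e \<subseteq> \<phi> ` U\<close>]) (auto simp: dist_norm norm_mult)
    then obtain y where "\<phi> x + \<i> * complex_of_real (e / 2) = \<phi> y" by blast
    then have "Im (\<phi> x + \<i> * complex_of_real (e / 2)) = Im (\<phi> y)" by simp
    then show False using \<open>e > 0\<close> by (simp add: \<phi>_def)
  qed
qed

lemma even_sphere_colours_differ:
  assumes "even_sphere_triangulation K col" "S \<in> triangles K" "T \<in> triangles K" "S \<noteq> T"
    and "E \<in> K" "1 simplex E" "E \<subseteq> S" "E \<subseteq> T"
  shows "col S \<noteq> col T"
  using assms unfolding even_sphere_triangulation_def by blast

text \<open>A simplex of higher dimension has four vertices \<open>a\<close>, \<open>b\<close>,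
  \<open>c\<close>, \<open>d\<close>. The three triangles through \<open>a\<close> on them share
  edges pairwise and would need three colours.\<close>

lemma even_sphere_triangulation_dim:
  assumes K: "even_sphere_triangulation K col" and S: "S \<in> K" "n simplex S"
  shows "n \<le> 2"
proof (rule ccontr)
  assume "\<not> n \<le> 2"
  have sK: "simplicial_complex K" using K by (simp add: even_sphere_triangulation_def)
  obtain C where C: "\<not> affine_dependent C" "finite C" "S = convex hull C"
    "C = {x \<in> S. {x} \<in> K}" "C = {x. x extreme_point_of S}"
    by (rule simplex_vertices[OF sK S(1)])
  have "int (card C) - 1 = n"
    using aff_dim_simplex[OF S(2)] C(1-3) by (simp add: aff_dim_convex_hull aff_dim_affine_independent)
  then have "4 \<le> card C" using \<open>\<not> n \<le> 2\<close> by linarith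
  then obtain A where A: "A \<subseteq> C" "card A = 4" using obtain_subset_with_card_n by metis
  then obtain a b c d where abcd: "A = {a, b, c, d}" "distinct [a, b, c, d]"
    by (auto simp: card_Suc_eq numeral_eq_Suc)
  note sub = simplex_sub_hull[OF sK S(1), folded C(4)]
  have tri: "convex hull {u, v, w} \<in> triangles K" if "{u, v, w} \<subseteq> A" "distinct [u, v, w]" for u v w
  proof -
    have "card {u, v, w} = 3" using that by auto
    then show ?thesis using sub(1,3)[of "{u, v, w}"] that A unfolding triangles_def by auto
  qed
  have edge: "convex hull {u, v} \<in> K \<and> 1 simplex (convex hull {u, v})" if "{u, v} \<subseteq> A" "u \<noteq> v" for u v
  proof -
    have "card {u, v} = 2" using that by auto
    then show ?thesis using sub(1,3)[of "{u, v}"] that A by auto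
  qed
  have ne: "col (convex hull {u, v, w}) \<noteq> col (convex hull {u, v, w'})"
    if "{u, v, w, w'} \<subseteq> A" "distinct [u, v, w, w']" for u v w w'
  proof -
    have "{u, v, w} \<subseteq> C" "{u, v, w'} \<subseteq> C" using that(1) A(1) by auto
    then have "w \<in> {x. x extreme_point_of convex hull {u, v, w}}"
      "w \<notin> {x. x extreme_point_of convex hull {u, v, w'}}"
      using sub(4)[of "{u, v, w}"] sub(4)[of "{u, v, w'}"] that(2) by auto
    then have "convex hull {u, v, w} \<noteq> convex hull {u, v, w'}" by metis
    moreover have "convex hull {u, v} \<subseteq> convex hull {u, v, w}" "convex hull {u, v} \<subseteq> convex hull {u, v, w'}"
      by (intro hull_mono; blast)+
    moreover have "convex hull {u, v, w} \<in> triangles K" "convex hull {u, v, w'} \<in> triangles K"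
      "convex hull {u, v} \<in> K" "1 simplex (convex hull {u, v})"
      using tri[of u v w] tri[of u v w'] edge[of u v] that by auto
    ultimately show ?thesis using even_sphere_colours_differ[OF K] by blast
  qed
  have eq: "{a, c, b} = {a, b, c}" "{a, d, b} = {a, b, d}" "{a, d, c} = {a, c, d}" by auto
  have "col (convex hull {a, b, c}) \<noteq> col (convex hull {a, b, d})"
    "col (convex hull {a, b, c}) \<noteq> col (convex hull {a, c, d})"
    "col (convex hull {a, b, d}) \<noteq> col (convex hull {a, c, d})"
    using ne[of a b c d] ne[of a c b d, unfolded eq] ne[of a d b c, unfolded eq] abcd by auto
  then show False
    by (cases "col (convex hull {a, b, c})"; cases "col (convex hull {a, b, d})";
        cases "col (convex hull {a, c, d})") simp_all
qed

section \<open>Hypertrees as triples of labels\<close>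

locale labelled_even_sphere =
  fixes n :: nat and K :: "'a::euclidean_space set set" and col :: "'a set \<Rightarrow> colour"
    and vert :: "nat \<Rightarrow> 'a"
  assumes even: "even_sphere_triangulation K col" and labelling: "vertex_labelling n K vert"
begin

abbreviation faces :: "colour \<Rightarrow> nat set set" where "faces \<equiv> hypertree n K col vert"

lemma simplicial: "simplicial_complex K" and homeo: "\<Union>K homeomorphic (sphere 0 1 :: (real ^ 3) set)"
  using even by (auto simp: even_sphere_triangulation_def)

lemma inj_vert: "inj_on vert {1..n}" and vert_image: "vert ` {1..n} = {x. {x} \<in> K}"
  using labelling unfolding vertex_labelling_def bij_betw_def by auto

lemma sub_hull:
  assumes "A \<subseteq> {1..n}" "S \<in> K" "vert ` A \<subseteq> S"
  shows "convex hull (vert ` A) \<in> K" "(int (card A) - 1) simplex (convex hull (vert ` A))"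
    "x extreme_point_of (convex hull (vert ` A)) \<longleftrightarrow> x \<in> vert ` A"
proof -
  have A: "vert ` A \<subseteq> {x \<in> S. {x} \<in> K}" using vert_image assms(1,3) by auto
  have "card (vert ` A) = card A" using inj_vert assms(1) by (meson card_image inj_on_subset)
  then show "convex hull (vert ` A) \<in> K" "(int (card A) - 1) simplex (convex hull (vert ` A))"
    "x extreme_point_of (convex hull (vert ` A)) \<longleftrightarrow> x \<in> vert ` A"
    using simplex_sub_hull[OF simplicial assms(2) A] by auto
qed

lemma triangle_labels:
  assumes T: "T \<in> triangles K"
  defines "A \<equiv> {i \<in> {1..n}. vert i extreme_point_of T}"
  shows "A \<subseteq> {1..n}" "card A = 3" "T = convex hull (vert ` A)" "A = {i \<in> {1..n}. vert i \<in> T}"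
proof -
  have TK: "T \<in> K" "2 simplex T" using T by (auto simp: triangles_def)
  obtain C where C: "\<not> affine_dependent C" "finite C" "T = convex hull C" "C = {x \<in> T. {x} \<in> K}"
      "C = {x. x extreme_point_of T}"
    by (rule simplex_vertices[OF simplicial TK(1)])
  show A: "A \<subseteq> {1..n}" unfolding A_def by blast
  have "C \<subseteq> vert ` {1..n}" unfolding vert_image using C(4) by blast
  then have CA: "vert ` A = C" using C(5) unfolding A_def by blast
  then show "T = convex hull (vert ` A)" using C(3) by argo
  have "int (card C) = 3"
    using aff_dim_simplex[OF TK(2)] C(1,3) by (metis aff_dim_affine_independent aff_dim_convex_hull
        add_diff_cancel_left' numeral_plus_one one_plus_numeral diff_add_cancel semiring_norm(2,3,5))
  then show "card A = 3" using CA inj_vert A by (metis card_image inj_on_subset of_nat_eq_iff of_nat_numeral)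
  show "A = {i \<in> {1..n}. vert i \<in> T}"
    using C(4,5) vert_image unfolding A_def by blast
qed

lemma faces_eq:
  "faces h = {A. A \<subseteq> {1..n} \<and> card A = 3 \<and> convex hull (vert ` A) \<in> triangles K \<and> col (convex hull (vert ` A)) = h}"
proof (intro equalityI subsetI)
  fix A assume "A \<in> faces h"
  then obtain T where T: "T \<in> triangles K" "col T = h" "A = {i \<in> {1..n}. vert i extreme_point_of T}"
    unfolding hypertree_def by blast
  show "A \<in> {A. A \<subseteq> {1..n} \<and> card A = 3 \<and> convex hull (vert ` A) \<in> triangles K \<and> col (convex hull (vert ` A)) = h}"
    using triangle_labels(1-3)[OF T(1)] T by simp
next
  fix A assume "A \<in> {A. A \<subseteq> {1..n} \<and> card A = 3 \<and> convex hull (vert ` A) \<in> triangles K \<and> col (convex hull (vert ` A)) = h}"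
  then have A: "A \<subseteq> {1..n}" "convex hull (vert ` A) \<in> triangles K" "col (convex hull (vert ` A)) = h" by auto
  have "convex hull (vert ` A) \<in> K" using A by (simp add: triangles_def)
  then have "A = {i \<in> {1..n}. vert i extreme_point_of (convex hull (vert ` A))}"
    using sub_hull(3)[OF A(1) _ hull_subset] A(1) inj_vert by (auto dest: inj_onD)
  then show "A \<in> faces h" using A unfolding hypertree_def by blast
qed

lemma faces_card: "T \<in> faces h \<Longrightarrow> card T = 3" and faces_subset: "T \<in> faces h \<Longrightarrow> T \<subseteq> {1..n}"
  by (auto simp: faces_eq)

lemma finite_faces: "finite (faces h)"
  by (rule finite_subset[of _ "Pow {1..n}"]) (auto simp: faces_eq)

text \<open>There are two triangles on the edge and their colours differ, so both colours
  occur.\<close>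

lemma edge_triangle:
  assumes "i \<in> {1..n}" "j \<in> {1..n}" "i \<noteq> j" "S \<in> K" "vert i \<in> S" "vert j \<in> S"
  shows "\<exists>B\<in>faces h. i \<in> B \<and> j \<in> B"
proof -
  define E where "E = convex hull (vert ` {i, j})"
  have E: "E \<in> K" "1 simplex E"
    using sub_hull(1,2)[of "{i, j}" S] assms unfolding E_def by auto
  have ijE: "vert i \<in> E" "vert j \<in> E" unfolding E_def by (auto intro: hull_inc)
  \<comment> \<open>Any \<open>T0\<close> yields a first triangle; taking that triangle as
    \<open>T0\<close> yields the second.\<close>
  have two: "\<exists>T\<in>triangles K. E \<subseteq> T \<and> T \<noteq> T0" for T0
    by (rule sphere_edge_in_two_triangles[OF simplicial homeo _ E, of T0])
      (use even_sphere_triangulation_dim[OF even] in blast)+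
  obtain T where T: "T \<in> triangles K" "E \<subseteq> T"
    using two by blast
  obtain T' where T': "T' \<in> triangles K" "E \<subseteq> T'" "T' \<noteq> T"
    using two by blast
  have "col T \<noteq> col T'" using even_sphere_colours_differ[OF even T(1) T'(1) _ E T(2) T'(2)] T'(3) by blast
  then have "col T = h \<or> col T' = h" by (cases h; cases "col T"; cases "col T'") auto
  then have "\<exists>T\<in>triangles K. E \<subseteq> T \<and> col T = h" using T T' by blast
  then obtain T where T: "T \<in> triangles K" "E \<subseteq> T" "col T = h" by blast
  have "{i \<in> {1..n}. vert i extreme_point_of T} \<in> faces h" using T unfolding hypertree_def by blast
  then show ?thesis
  proof (rule bexI[rotated], intro conjI)
    show "i \<in> {i \<in> {1..n}. vert i extreme_point_of T}"
      "j \<in> {i \<in> {1..n}. vert i extreme_point_of T}"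
    using triangle_labels(4)[OF T(1)] T(2) ijE assms(1,2) by auto
  qed
qed

lemma face_exists:
  assumes "i \<in> T" "j \<in> T" "i \<noteq> j" "T \<in> faces h'"
  shows "\<exists>B\<in>faces h. i \<in> B \<and> j \<in> B"
proof -
  have T: "T \<subseteq> {1..n}" "convex hull (vert ` T) \<in> K" using assms(4) by (auto simp: faces_eq triangles_def)
  then show ?thesis
    using assms by (intro edge_triangle[of i j "convex hull (vert ` T)"]) (auto intro: hull_inc)
qed

text \<open>Distinct triangles of one colour cannot share an edge, and a triangle determines its
  labels through its extreme points.\<close>

lemma face_unique:
  assumes "i \<in> B" "j \<in> B" "i \<in> B'" "j \<in> B'" "i \<noteq> j" "B \<in> faces h" "B' \<in> faces h"
  shows "B = B'"
proof -
  have B: "B \<subseteq> {1..n}" "convex hull (vert ` B) \<in> triangles K" "col (convex hull (vert ` B)) = h"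
    and B': "B' \<subseteq> {1..n}" "convex hull (vert ` B') \<in> triangles K" "col (convex hull (vert ` B')) = h"
    using assms(6,7) by (auto simp: faces_eq)
  have K: "convex hull (vert ` B) \<in> K" "convex hull (vert ` B') \<in> K" using B B' by (auto simp: triangles_def)
  have ij: "{i, j} \<subseteq> {1..n}" "vert ` {i, j} \<subseteq> convex hull (vert ` B)"
    using assms B(1) by (auto intro: hull_inc)
  have "convex hull (vert ` {i, j}) \<in> K" "1 simplex convex hull (vert ` {i, j})"
    using sub_hull(1,2)[OF ij(1) K(1) ij(2)] assms(5) by auto
  moreover have "convex hull (vert ` {i, j}) \<subseteq> convex hull (vert ` B)"
    "convex hull (vert ` {i, j}) \<subseteq> convex hull (vert ` B')"
    using assms by (intro hull_mono; auto)+
  ultimately have eq: "convex hull (vert ` B) = convex hull (vert ` B')"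
    using even_sphere_colours_differ[OF even B(2) B'(2)] B(3) B'(3) by metis
  have "x \<in> vert ` B \<longleftrightarrow> x \<in> vert ` B'" for x
    using sub_hull(3)[OF B(1) K(1) hull_subset, of x] sub_hull(3)[OF B'(1) K(2) hull_subset, of x]
    unfolding eq by blast
  then have "vert ` B = vert ` B'" by blast
  then show ?thesis using inj_vert B(1) B'(1) by (simp add: inj_on_image_eq_iff)
qed

text \<open>Reduces conditions on all simplices to conditions on triangles: three distinct vertices
  span one, and an edge lies in one of either colour (black is an arbitrary choice).\<close>

lemma simplex_in_face:
  assumes "i \<in> {1..n}" "j \<in> {1..n}" "k \<in> {1..n}" "S \<in> K" "vert i \<in> S" "vert j \<in> S" "vert k \<in> S"
  shows "i = j \<and> j = k \<or> (\<exists>h. \<exists>T\<in>faces h. i \<in> T \<and> j \<in> T \<and> k \<in> T)"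
proof (cases "distinct [i, j, k]")
  case True
  then have "card {i, j, k} = 3" by simp
  then have "{i, j, k} \<in> faces (col (convex hull (vert ` {i, j, k})))"
    using sub_hull(1,2)[of "{i, j, k}" S] assms by (simp add: faces_eq triangles_def)
  then show ?thesis by blast
next
  case False
  then show ?thesis
    using edge_triangle[of i j S Black] edge_triangle[of j k S Black] edge_triangle[of i k S Black] assms
    by (cases "i = j"; cases "j = k"; cases "i = k") auto
qed

lemma vert_inverse:
  obtains \<mu> where "\<And>i. i \<in> {1..n} \<Longrightarrow> \<mu> (vert i) = i"
    "\<And>x. {x} \<in> K \<Longrightarrow> \<mu> x \<in> {1..n} \<and> vert (\<mu> x) = x"
proof (rule that)
  show "inv_into {1..n} vert (vert i) = i" if "i \<in> {1..n}" for i
    using inj_vert that by (rule inv_into_f_f)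
  show "inv_into {1..n} vert x \<in> {1..n} \<and> vert (inv_into {1..n} vert x) = x" if "{x} \<in> K" for x
    using that vert_image inv_into_into[of x vert "{1..n}"] f_inv_into_f[of x vert "{1..n}"] by blast
qed

text \<open>The sphere is simply connected. The condition on \<open>c i i\<close> covers triples of
  equal labels, for which \<open>simplex_in_face\<close> supplies no triangle.\<close>

lemma cocycle_exact:
  fixes c :: "nat \<Rightarrow> nat \<Rightarrow> 'g::ab_group_add"
  assumes diag: "\<And>i. i \<in> {1..n} \<Longrightarrow> c i i = 0"
    and c: "\<And>h T i j k. T \<in> faces h \<Longrightarrow> i \<in> T \<Longrightarrow> j \<in> T \<Longrightarrow> k \<in> T \<Longrightarrow> c i j + c j k = c i k"
  obtains y where "\<And>h T i j. T \<in> faces h \<Longrightarrow> i \<in> T \<Longrightarrow> j \<in> T \<Longrightarrow> c i j = y j - y i"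
proof -
  obtain \<mu> where l: "\<And>i. i \<in> {1..n} \<Longrightarrow> \<mu> (vert i) = i"
    "\<And>x. {x} \<in> K \<Longrightarrow> \<mu> x \<in> {1..n} \<and> vert (\<mu> x) = x" using vert_inverse by blast
  have sc: "simply_connected (\<Union>K)"
    using homeomorphic_simply_connected_eq[OF homeo] by (simp add: simply_connected_sphere)
  have "c (\<mu> u) (\<mu> v) + c (\<mu> v) (\<mu> w) = c (\<mu> u) (\<mu> w)"
    if S: "S \<in> K" "u \<in> S" "v \<in> S" "w \<in> S" "{u} \<in> K" "{v} \<in> K" "{w} \<in> K" for S u v w
    using simplex_in_face[of "\<mu> u" "\<mu> v" "\<mu> w" S] l(2) S c diag by (metis add_0)
  then obtain h where h:
    "\<And>T u v. T \<in> K \<Longrightarrow> u \<in> T \<Longrightarrow> v \<in> T \<Longrightarrow> {u} \<in> K \<Longrightarrow> {v} \<in> K \<Longrightarrow> c (\<mu> u) (\<mu> v) = h v - h u"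
    using simplicial_cocycle_exact[OF simplicial sc, of "\<lambda>u v. c (\<mu> u) (\<mu> v)"] by blast
  show thesis
  proof (rule that)
    fix g T i j assume T: "T \<in> faces g" "i \<in> T" "j \<in> T"
    then have T': "T \<subseteq> {1..n}" "convex hull (vert ` T) \<in> K" by (auto simp: faces_eq triangles_def)
    moreover have "vert i \<in> convex hull (vert ` T)" "vert j \<in> convex hull (vert ` T)"
      using T by (auto intro: hull_inc)
    moreover have "{vert i} \<in> K" "{vert j} \<in> K" using T T'(1) vert_image by blast+
    ultimately have "c (\<mu> (vert i)) (\<mu> (vert j)) = h (vert j) - h (vert i)" by (intro h)
    then show "c i j = h (vert j) - h (vert i)" using l(1) T T'(1) by (simp add: subset_eq)
  qed
qed

lemma locally_constant:
  assumes f: "\<And>h T i j. T \<in> faces h \<Longrightarrow> i \<in> T \<Longrightarrow> j \<in> T \<Longrightarrow> f i = f j"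
    and ij: "i \<in> {1..n}" "j \<in> {1..n}"
  shows "f i = f j"
proof -
  obtain \<mu> where l: "\<And>i. i \<in> {1..n} \<Longrightarrow> \<mu> (vert i) = i"
    "\<And>x. {x} \<in> K \<Longrightarrow> \<mu> x \<in> {1..n} \<and> vert (\<mu> x) = x" using vert_inverse by blast
  have "simply_connected (\<Union>K)"
    using homeomorphic_simply_connected_eq[OF homeo] by (simp add: simply_connected_sphere)
  then have con: "connected (\<Union>K)" by (rule simply_connected_imp_connected)
  have "f (\<mu> (vert i)) = f (\<mu> (vert j))"
  proof (rule simplicial_locally_constant[OF simplicial con, of "\<lambda>x. f (\<mu> x)"])
    fix S u v assume "S \<in> K" "u \<in> S" "v \<in> S" "{u} \<in> K" "{v} \<in> K"
    then show "f (\<mu> u) = f (\<mu> v)"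
      using simplex_in_face[of "\<mu> u" "\<mu> v" "\<mu> v" S] l(2) f by metis
  qed (use ij vert_image in auto)
  then show ?thesis using l(1) ij by simp
qed

end

section \<open>Transposed kernels and bipartite graphs\<close>

text \<open>Gaussian elimination: equation \<open>j\<close> is solved for an unknown with nonzero
  coefficient, which is then substituted into the remaining equations.\<close>

lemma homogeneous_system_nontrivial:
  fixes N :: "'i \<Rightarrow> 'j \<Rightarrow> 'k::field"
  assumes "finite J" "finite I" "card J < card I"
  shows "\<exists>t. (\<exists>i\<in>I. t i \<noteq> 0) \<and> (\<forall>j\<in>J. (\<Sum>i\<in>I. t i * N i j) = 0)"
  using assms
proof (induction J arbitrary: I N rule: finite_induct)
  case empty
  then have "I \<noteq> {}" by auto
  then show ?case by (intro exI[of _ "\<lambda>_. 1"]) auto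
next
  case (insert j J)
  show ?case
  proof (cases "\<forall>i\<in>I. N i j = 0")
    case True
    have "card J < card I" using insert.prems insert.hyps by simp
    then obtain t where "\<exists>i\<in>I. t i \<noteq> 0" "\<forall>j\<in>J. (\<Sum>i\<in>I. t i * N i j) = 0"
      using insert.IH[OF insert.prems(1), of N] by blast
    then show ?thesis using True by (intro exI[of _ t]) auto
  next
    case False
    then obtain i0 where i0: "i0 \<in> I" "N i0 j \<noteq> 0" by blast
    define I' where "I' = I - {i0}"
    have I': "finite I'" "card J < card I'" "I = insert i0 I'" "i0 \<notin> I'"
      using insert.prems insert.hyps i0(1) by (auto simp: I'_def card_Diff_singleton)
    obtain t where t: "\<exists>i\<in>I'. t i \<noteq> 0"
      "\<forall>j'\<in>J. (\<Sum>i\<in>I'. t i * (N i j' - N i j / N i0 j * N i0 j')) = 0"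
      using insert.IH[OF I'(1,2), of "\<lambda>i j'. N i j' - N i j / N i0 j * N i0 j'"] by blast
    define r where "r = - (\<Sum>i\<in>I'. t i * N i j) / N i0 j"
    have sum: "(\<Sum>i\<in>I. (t(i0 := r)) i * N i j') = r * N i0 j' + (\<Sum>i\<in>I'. t i * N i j')" for j'
    proof -
      have "(\<Sum>i\<in>I'. (t(i0 := r)) i * N i j') = (\<Sum>i\<in>I'. t i * N i j')"
        using I'(4) by (intro sum.cong) auto
      then show ?thesis using I' by simp
    qed
    have "(\<Sum>i\<in>I. (t(i0 := r)) i * N i j') = 0" if "j' \<in> insert j J" for j'
    proof (cases "j' = j")
      case True
      then show ?thesis using i0(2) by (simp only: sum) (simp add: r_def)
    next
      case False
      then have "0 = (\<Sum>i\<in>I'. t i * (N i j' - N i j / N i0 j * N i0 j'))" using t(2) that by simp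
      also have "\<dots> = (\<Sum>i\<in>I'. t i * N i j' - t i * N i j * (N i0 j' / N i0 j))"
        by (intro sum.cong) (auto simp: algebra_simps)
      also have "\<dots> = (\<Sum>i\<in>I'. t i * N i j') - (\<Sum>i\<in>I'. t i * N i j) * (N i0 j' / N i0 j)"
        by (simp only: sum_subtractf sum_distrib_right)
      also have "\<dots> = r * N i0 j' + (\<Sum>i\<in>I'. t i * N i j')" by (simp add: r_def)
      finally show ?thesis by (simp only: sum)
    qed
    moreover have "\<exists>i\<in>I. (t(i0 := r)) i \<noteq> 0"
    proof -
      obtain i where "i \<in> I'" "t i \<noteq> 0" using t(1) by blast
      then show ?thesis using I'(3,4) by (intro bexI[of _ i]) auto
    qed
    ultimately show ?thesis by blast
  qed
qed

text \<open>A square matrix with vanishing row sums whose kernel contains a further vector has corank at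
  least two, hence so has its transpose.\<close>

lemma transpose_kernel_nonconstant:
  fixes N :: "'i \<Rightarrow> 'j \<Rightarrow> 'k::field"
  assumes fin: "finite I" "finite J" and card: "card I = card J"
    and one: "\<And>i. i \<in> I \<Longrightarrow> (\<Sum>j\<in>J. N i j) = 0"
    and s: "\<And>i. i \<in> I \<Longrightarrow> (\<Sum>j\<in>J. N i j * s j) = 0"
    and j: "j0 \<in> J" "j1 \<in> J" "s j0 \<noteq> s j1"
  obtains t i0 i1 where "i0 \<in> I" "i1 \<in> I" "t i0 \<noteq> t i1" "\<And>j. j \<in> J \<Longrightarrow> (\<Sum>i\<in>I. t i * N i j) = 0"
proof -
  have "j0 \<noteq> j1" using j by auto
  then have J: "J = insert j0 (insert j1 (J - {j0, j1}))" using j by auto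
  have "card {j0, j1} \<le> card J" using fin j by (intro card_mono) auto
  then have J2: "2 \<le> card J" "card (J - {j0, j1}) = card J - 2"
    using fin j \<open>j0 \<noteq> j1\<close> by (auto simp: card_Diff_subset)
  then obtain i0 where i0: "i0 \<in> I" using card by fastforce
  \<comment> \<open>Setting the unknown at \<open>i0\<close> to zero makes every nonzero solution
    nonconstant. This costs one unknown, so two equations, those of \<open>j0\<close> and
    \<open>j1\<close>, are dropped to keep more unknowns than equations.\<close>
  have "card (J - {j0, j1}) < card (I - {i0})" using J2 card i0 fin by simp
  then obtain t where t: "\<exists>i\<in>I - {i0}. t i \<noteq> 0"
    "\<forall>j\<in>J - {j0, j1}. (\<Sum>i\<in>I - {i0}. t i * N i j) = 0"
    using homogeneous_system_nontrivial[of "J - {j0, j1}" "I - {i0}" N] fin by auto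
  define t' where "t' = t(i0 := 0)"
  define x where "x j = (\<Sum>i\<in>I. t' i * N i j)" for j
  have "x j = (\<Sum>i\<in>I - {i0}. t i * N i j)" for j
    unfolding x_def t'_def using fin i0 by (subst sum.remove[OF _ i0]) auto
  then have x0: "x j = 0" if "j \<in> J - {j0, j1}" for j using t(2) that by simp
  have sum: "(\<Sum>j\<in>J. x j * r j) = x j0 * r j0 + x j1 * r j1" for r
  proof -
    have "(\<Sum>j\<in>J - {j0, j1}. x j * r j) = 0" using x0 by simp
    then show ?thesis using fin \<open>j0 \<noteq> j1\<close> by (subst J) simp
  qed
  \<comment> \<open>The residual \<open>x\<close> lives on the two dropped columns. Pairing it with
    the kernel vectors 1 and \<open>s\<close> gives two equations, independent since
    \<open>s j0\<close> and \<open>s j1\<close> differ, so the dropped equations hold as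
    well.\<close>
  have swap: "(\<Sum>j\<in>J. x j * r j) = (\<Sum>i\<in>I. t' i * (\<Sum>j\<in>J. N i j * r j))" for r
    unfolding x_def sum_distrib_right sum_distrib_left mult.assoc by (rule sum.swap)
  have 1: "x j0 + x j1 = 0" using sum[of "\<lambda>_. 1"] swap[of "\<lambda>_. 1"] one by simp
  have 2: "x j0 * s j0 + x j1 * s j1 = 0" using sum[of s] swap[of s] s by simp
  have "x j1 = - x j0" using 1 by (simp add: eq_neg_iff_add_eq_0 add.commute)
  then have "x j0 * (s j0 - s j1) = 0" using 2 by (simp add: algebra_simps)
  then have "x j0 = 0" "x j1 = 0" using j \<open>x j1 = - x j0\<close> by auto
  then have "x j = 0" if "j \<in> J" for j using x0 that by blast
  moreover obtain i1 where "i1 \<in> I - {i0}" "t i1 \<noteq> 0" using t(1) by blast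
  then have "i1 \<in> I" "t' i1 \<noteq> t' i0" unfolding t'_def by auto
  ultimately show thesis using that[of i1 i0 t'] i0 unfolding x_def by blast
qed

text \<open>A graph whose edges form two perfect matchings is bipartite: contract an edge of the first
  matching, joining its two neighbours along the second one.\<close>

lemma two_matchings_bipartite:
  assumes "finite L" and "\<And>x. x \<in> L \<Longrightarrow> \<beta> x \<in> L \<and> \<beta> x \<noteq> x \<and> \<beta> (\<beta> x) = x"
    and "\<And>x. x \<in> L \<Longrightarrow> \<omega> x \<in> L \<and> \<omega> x \<noteq> x \<and> \<omega> (\<omega> x) = x"
  shows "\<exists>f :: 'a \<Rightarrow> bit. \<forall>x\<in>L. f (\<beta> x) \<noteq> f x \<and> f (\<omega> x) \<noteq> f x"
  using assms
proof (induction L arbitrary: \<omega> rule: finite_psubset_induct)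
  case (psubset L)
  note b = psubset.prems(1) and w = psubset.prems(2)
  show ?case
  proof (cases "L = {}")
    case False
    then obtain x where x: "x \<in> L" by blast
    define y where "y = \<beta> x"
    have y: "y \<in> L" "y \<noteq> x" "\<beta> y = x" using b[OF x] by (auto simp: y_def)
    define L' where "L' = L - {x, y}"
    have L': "L' \<subset> L" using x by (auto simp: L'_def)
    have b': "\<beta> u \<in> L' \<and> \<beta> u \<noteq> u \<and> \<beta> (\<beta> u) = u" if "u \<in> L'" for u
      using b[of u] that y unfolding L'_def y_def by auto
    show ?thesis
    proof (cases "\<omega> x = y")
      case True
      \<comment> \<open>The edge belongs to both matchings, so \<open>x\<close> and \<open>y\<close>
        form a component by themselves.\<close>
      have "\<omega> y = x" using w[OF x] True by simp
      then have "\<omega> u \<in> L' \<and> \<omega> u \<noteq> u \<and> \<omega> (\<omega> u) = u" if "u \<in> L'" for u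
        using w[of u] that True unfolding L'_def by auto
      then obtain f :: "'a \<Rightarrow> bit" where f: "\<forall>u\<in>L'. f (\<beta> u) \<noteq> f u \<and> f (\<omega> u) \<noteq> f u"
        using psubset.IH[OF L' b'] by blast
      define g where "g u = (if u = x then 0 else if u = y then 1 else f u)" for u
      have "g (\<beta> u) \<noteq> g u \<and> g (\<omega> u) \<noteq> g u" if "u \<in> L" for u
      proof (cases "u \<in> L'")
        case True
        then have "\<beta> u \<in> L'" "\<omega> u \<in> L'" using b' \<open>\<And>u. u \<in> L' \<Longrightarrow> \<omega> u \<in> L' \<and> _\<close> by blast+
        then show ?thesis using f True unfolding g_def L'_def by auto
      next
        case False
        then have "u = x \<or> u = y" using that by (auto simp: L'_def)
        then show ?thesis using \<open>\<omega> y = x\<close> True y y_def by (auto simp: g_def)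
      qed
      then show ?thesis by blast
    next
      case False
      define p q where "p = \<omega> x" and "q = \<omega> y"
      have p: "p \<in> L'" "\<omega> p = x" using w[OF x] False by (auto simp: p_def L'_def)
      have q: "q \<in> L'" "\<omega> q = y" using w[OF y(1)] w[OF x] False by (auto simp: q_def L'_def)
      have pq: "p \<noteq> q" using p q y(2) by auto
      define \<omega>' where "\<omega>' u = (if u = p then q else if u = q then p else \<omega> u)" for u
      have w': "\<omega>' u \<in> L' \<and> \<omega>' u \<noteq> u \<and> \<omega>' (\<omega>' u) = u" if "u \<in> L'" for u
      proof (cases "u = p \<or> u = q")
        case True
        then show ?thesis using p q pq by (auto simp: \<omega>'_def)
      next
        case False
        then have u: "u \<in> L" "u \<noteq> x" "u \<noteq> y" "u \<noteq> p" "u \<noteq> q" using that by (auto simp: L'_def)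
        have "\<omega> u \<noteq> x" "\<omega> u \<noteq> y" "\<omega> u \<noteq> p" "\<omega> u \<noteq> q"
          using w[OF u(1)] u p q unfolding p_def q_def by auto
        then show ?thesis using w[OF u(1)] u by (auto simp: \<omega>'_def L'_def)
      qed
      obtain f :: "'a \<Rightarrow> bit" where f: "\<forall>u\<in>L'. f (\<beta> u) \<noteq> f u \<and> f (\<omega>' u) \<noteq> f u"
        using psubset.IH[OF L' b' w'] by blast
      have fpq: "f p \<noteq> f q" using f p(1) by (auto simp: \<omega>'_def)
      \<comment> \<open>The path from \<open>p\<close> through \<open>x\<close> and \<open>y\<close>
        to \<open>q\<close> is coloured alternately; this fits because \<open>p\<close> and
        \<open>q\<close>, joined by the new edge, received different colours.\<close>
      define g where "g u = (if u = x then f q else if u = y then f p else f u)" for u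
      have gL: "g u = f u" if "u \<in> L'" for u using that by (auto simp: g_def L'_def)
      have gxy: "g x = f q" "g y = f p" using y(2) by (auto simp: g_def)
      have "g (\<beta> u) \<noteq> g u \<and> g (\<omega> u) \<noteq> g u" if u: "u \<in> L" for u
      proof -
        consider "u = x" | "u = y" | "u = p" | "u = q" | "u \<in> L'" "u \<noteq> p" "u \<noteq> q"
          using u by (auto simp: L'_def)
        then show ?thesis
        proof cases
          case 1
          then show ?thesis using gxy fpq gL[OF p(1)] y_def p_def by auto
        next
          case 2
          then show ?thesis using gxy fpq gL[OF q(1)] y(3) q_def by auto
        next
          case 3
          then show ?thesis using gxy fpq p gL[OF p(1)] gL[of "\<beta> p"] b'[OF p(1)] f by auto
        next
          case 4
          then show ?thesis using gxy fpq q gL[OF q(1)] gL[of "\<beta> q"] b'[OF q(1)] f by auto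
        next
          case 5
          then have "\<omega>' u = \<omega> u" by (simp add: \<omega>'_def)
          then show ?thesis using 5 gL[of u] gL[of "\<beta> u"] gL[of "\<omega> u"] b'[of u] w'[of u] f by auto
        qed
      qed
      then show ?thesis by blast
    qed
  qed simp
qed

section \<open>Links of vertices and orientability\<close>

context labelled_even_sphere
begin

lemma third_vertex:
  assumes "i \<in> T" "j \<in> T" "i \<noteq> j" "T \<in> faces h'"
  shows "\<exists>!k. k \<noteq> i \<and> k \<noteq> j \<and> {i, j, k} \<in> faces h"
proof -
  obtain B where B: "B \<in> faces h" "i \<in> B" "j \<in> B" using face_exists[OF assms] by blast
  have "card (B - {i, j}) = 1" using faces_card[OF B(1)] B(2,3) assms(3) by (simp add: card_Diff_subset)
  then obtain k where "B - {i, j} = {k}" by (auto simp: card_1_singleton_iff)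
  then have k: "B = {i, j, k}" "k \<noteq> i" "k \<noteq> j" using B by auto
  show ?thesis
  proof (rule ex1I)
    show "k \<noteq> i \<and> k \<noteq> j \<and> {i, j, k} \<in> faces h" using B k by simp
  next
    fix l assume l: "l \<noteq> i \<and> l \<noteq> j \<and> {i, j, l} \<in> faces h"
    then have "{i, j, l} = B" using face_unique[of i "{i, j, l}" j B h] B assms(3) by simp
    then show "l = k" using k l by auto
  qed
qed

text \<open>Each neighbour of \<open>v\<close> lies with \<open>v\<close> in exactly one black and
  one white triangle. The third vertices of these give two perfect matchings of the neighbours,
  whose edges are those of the link.\<close>

lemma link_colouring:
  obtains f :: "nat \<Rightarrow> bit" where
    "\<And>h T i j. T \<in> faces h \<Longrightarrow> v \<in> T \<Longrightarrow> i \<in> T \<Longrightarrow> j \<in> T \<Longrightarrow> distinct [v, i, j] \<Longrightarrow> f i \<noteq> f j"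
proof -
  define L where "L = {i. i \<noteq> v \<and> (\<exists>h. \<exists>T\<in>faces h. v \<in> T \<and> i \<in> T)}"
  define \<tau> where "\<tau> h i = (THE k. k \<noteq> v \<and> k \<noteq> i \<and> {v, i, k} \<in> faces h)" for h i
  have "L \<subseteq> {1..n}" using faces_subset unfolding L_def by blast
  then have "finite L" using finite_subset by blast
  have third: "\<exists>!k. k \<noteq> v \<and> k \<noteq> i \<and> {v, i, k} \<in> faces h" if i: "i \<in> L" for h i
  proof -
    obtain h' T where "T \<in> faces h'" "v \<in> T" "i \<in> T" "i \<noteq> v" using i unfolding L_def by blast
    then show ?thesis using third_vertex[of v T i h' h] by blast
  qed
  have tau: "\<tau> h i \<noteq> v \<and> \<tau> h i \<noteq> i \<and> {v, i, \<tau> h i} \<in> faces h" if "i \<in> L" for h i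
    unfolding \<tau>_def by (rule theI'[OF third[OF that]])
  have tau_eq: "\<tau> h i = k" if "i \<in> L" "k \<noteq> v" "k \<noteq> i" "{v, i, k} \<in> faces h" for h i k
    unfolding \<tau>_def by (rule the1_equality[OF third[OF that(1)]]) (use that in blast)
  have match: "\<tau> h i \<in> L \<and> \<tau> h i \<noteq> i \<and> \<tau> h (\<tau> h i) = i" if i: "i \<in> L" for h i
  proof -
    have "\<tau> h i \<in> L" using tau[OF i, of h] unfolding L_def by blast
    moreover have "\<tau> h (\<tau> h i) = i"
      using tau[OF i, of h] i by (intro tau_eq[OF \<open>\<tau> h i \<in> L\<close>]) (auto simp: L_def insert_commute)
    ultimately show ?thesis using tau[OF i] by blast
  qed
  then obtain f :: "nat \<Rightarrow> bit" where f: "\<forall>i\<in>L. f (\<tau> Black i) \<noteq> f i \<and> f (\<tau> White i) \<noteq> f i"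
    using two_matchings_bipartite[OF \<open>finite L\<close>, of "\<tau> Black" "\<tau> White"] by blast
  show thesis
  proof (rule that)
    fix h T i j assume T: "T \<in> faces h" "v \<in> T" "i \<in> T" "j \<in> T" "distinct [v, i, j]"
    then have "i \<in> L" unfolding L_def by auto
    have "{v, i, j} = T"
      using T faces_card[OF T(1)] by (intro card_seteq) (auto simp: card_ge_0_finite)
    then have "\<tau> h i = j" using T \<open>i \<in> L\<close> by (intro tau_eq) auto
    then show "f i \<noteq> f j" using f \<open>i \<in> L\<close> by (cases h) metis+
  qed
qed

text \<open>The sphere is orientable: the local orientations around the vertices given by two-colourings
  of their links differ by a cocycle modulo two.  Here \<open>d i j = 0\<close> means that the edge is directed
  from \<open>i\<close> to \<open>j\<close>; black and white triangles induce the same direction on a common edge.\<close>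

lemma orientation:
  obtains d :: "nat \<Rightarrow> nat \<Rightarrow> bit" where
    "\<And>h T i j. T \<in> faces h \<Longrightarrow> i \<in> T \<Longrightarrow> j \<in> T \<Longrightarrow> i \<noteq> j \<Longrightarrow> d i j \<noteq> d j i"
    "\<And>h T i j k. T \<in> faces h \<Longrightarrow> i \<in> T \<Longrightarrow> j \<in> T \<Longrightarrow> k \<in> T \<Longrightarrow> distinct [i, j, k] \<Longrightarrow> d i j \<noteq> d i k"
proof -
  have "\<exists>f :: nat \<Rightarrow> bit. \<forall>h T i j. T \<in> faces h \<longrightarrow> v \<in> T \<longrightarrow> i \<in> T \<longrightarrow> j \<in> T \<longrightarrow> distinct [v, i, j] \<longrightarrow> f i \<noteq> f j"
    for v by (rule link_colouring[of v]) blast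
  then obtain f :: "nat \<Rightarrow> nat \<Rightarrow> bit" where
    f: "\<And>v h T i j. T \<in> faces h \<Longrightarrow> v \<in> T \<Longrightarrow> i \<in> T \<Longrightarrow> j \<in> T \<Longrightarrow> distinct [v, i, j] \<Longrightarrow> f v i \<noteq> f v j"
    by metis
  \<comment> \<open>For distinct \<open>i\<close> and \<open>j\<close> this is zero exactly when the
    local orientations at the two ends give the edge one direction. The potential \<open>y\<close>
    then marks the vertices at which the two colours of the link must be swapped.\<close>
  define c where "c i j = (if i = j then 0 else f i j + f j i + 1)" for i j
  have bit: "b = a + 1" if "a \<noteq> b" for a b :: bit using that by (cases a; cases b) simp_all
  have cc: "c i j + c j k = c i k" if T: "T \<in> faces h" "i \<in> T" "j \<in> T" "k \<in> T" for h T i j k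
  proof (cases "distinct [i, j, k]")
    case True
    \<comment> \<open>At each corner of the triangle the two colours sum to one; these three ones
      cancel the three summands 1 in the definition of \<open>c\<close>.\<close>
    have "f i k = f i j + 1" "f j k = f j i + 1" "f k i = f k j + 1"
      using f[of T h i j k] f[of T h j i k] f[of T h k j i] T True by (auto intro!: bit)
    then show ?thesis using True unfolding c_def
      by (cases "f i j"; cases "f j i"; cases "f k j") simp_all
  next
    case False
    then show ?thesis unfolding c_def
      by (cases "f i j"; cases "f j i"; cases "f k j"; cases "f j k"; auto)
  qed
  obtain y where y: "\<And>h T i j. T \<in> faces h \<Longrightarrow> i \<in> T \<Longrightarrow> j \<in> T \<Longrightarrow> c i j = y j - y i"
    using cocycle_exact[of c] cc by (auto simp: c_def)
  show thesis
  proof (rule that[of "\<lambda>i j. f i j + y i"])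
    fix h T i j assume T: "T \<in> faces h" "i \<in> T" "j \<in> T" "i \<noteq> (j :: nat)"
    then have "f i j + f j i + 1 = y j - y i" using y[OF T(1-3)] by (simp add: c_def)
    then show "f i j + y i \<noteq> f j i + y j"
      by (cases "f i j"; cases "f j i"; cases "y i"; cases "y j") simp_all
  next
    fix h T i j k assume "T \<in> faces h" "i \<in> T" "j \<in> T" "k \<in> T" "distinct [i, j, k]"
    then show "f i j + y i \<noteq> f i k + y i" using f[of T h i j k] by auto
  qed
qed

end

section \<open>Exchanging the colours\<close>

definition affine_on :: "('i \<Rightarrow> 'k::field) \<Rightarrow> ('i \<Rightarrow> 'k) \<Rightarrow> 'i set \<Rightarrow> bool" where
  "affine_on z y S \<longleftrightarrow> (\<exists>\<sigma> \<beta>. \<forall>i\<in>S. y i = \<sigma> * z i + \<beta>)"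

context labelled_even_sphere
begin

text \<open>Triangles of either colour partition the same set of ordered edges, six to each
  triangle. This makes the slope system square.\<close>

lemma card_faces_eq: "card (faces h) = card (faces h')"
proof -
  define pairs where "pairs T = {(i, j). i \<in> T \<and> j \<in> T \<and> i \<noteq> j}" for T :: "nat set"
  have six: "card (pairs T) = 6 \<and> finite (pairs T)" if T: "T \<in> faces g" for T g
  proof -
    obtain a b c where "T = {a, b, c}" "distinct [a, b, c]"
      using faces_card[OF T] by (auto simp: card_3_iff)
    then have "pairs T = {(a, b), (a, c), (b, a), (b, c), (c, a), (c, b)}" unfolding pairs_def by auto
    then show ?thesis using \<open>distinct [a, b, c]\<close> by auto
  qed
  have count: "card (\<Union>T\<in>faces g. pairs T) = 6 * card (faces g)" for g
  proof -
    have "card (\<Union>T\<in>faces g. pairs T) = (\<Sum>T\<in>faces g. card (pairs T))"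
    proof (rule card_UN_disjoint)
      show "\<forall>T\<in>faces g. \<forall>T'\<in>faces g. T \<noteq> T' \<longrightarrow> pairs T \<inter> pairs T' = {}"
      proof (intro ballI impI equals0I)
        fix T T' x assume T: "T \<in> faces g" "T' \<in> faces g" "T \<noteq> T'" "x \<in> pairs T \<inter> pairs T'"
        then obtain i j where "i \<in> T" "j \<in> T" "i \<in> T'" "j \<in> T'" "i \<noteq> j" unfolding pairs_def by blast
        then show False using face_unique T(1-3) by blast
      qed
    qed (use six finite_faces in auto)
    then show ?thesis using six by simp
  qed
  have "(\<Union>T\<in>faces g. pairs T) \<subseteq> (\<Union>T\<in>faces g'. pairs T)" for g g'
  proof
    fix x assume "x \<in> (\<Union>T\<in>faces g. pairs T)"
    then obtain T i j where T: "T \<in> faces g" "i \<in> T" "j \<in> T" "i \<noteq> j" "x = (i, j)"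
      unfolding pairs_def by blast
    then obtain B where "B \<in> faces g'" "i \<in> B" "j \<in> B" using face_exists by blast
    then have "B \<in> faces g'" "x \<in> pairs B" using T unfolding pairs_def by blast+
    then show "x \<in> (\<Union>T\<in>faces g'. pairs T)" by (rule UN_I)
  qed
  then have "(\<Union>T\<in>faces h. pairs T) = (\<Union>T\<in>faces h'. pairs T)" by blast
  then show ?thesis using count[of h] count[of h'] by simp
qed

definition face_at :: "colour \<Rightarrow> nat \<Rightarrow> nat \<Rightarrow> nat set" where
  "face_at h i j = (THE B. B \<in> faces h \<and> i \<in> B \<and> j \<in> B)"

lemma face_at_eq:
  assumes "B \<in> faces h" "i \<in> B" "j \<in> B" "i \<noteq> j"
  shows "face_at h i j = B"
  unfolding face_at_def using assms face_unique by (intro the_equality) blast+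

text \<open>The matrix of the linear system for the slopes has entries \<open>N A B\<close>, the sum of \<open>dz\<close> over the
  directed edges common to \<open>A\<close> and \<open>B\<close>; this is symmetric in the two triangles.\<close>

lemma affine_transfer:
  fixes z y :: "nat \<Rightarrow> 'k::field"
  assumes z: "inj_on z {1..n}" and "h \<noteq> h'"
    and aff: "\<forall>T\<in>faces h. affine_on z y T" and naff: "\<not> affine_on z y {1..n}"
  shows "\<exists>y'. (\<forall>T\<in>faces h'. affine_on z y' T) \<and> \<not> affine_on z y' {1..n}"
proof -
  obtain d :: "nat \<Rightarrow> nat \<Rightarrow> bit" where
    d1: "\<And>h T i j. T \<in> faces h \<Longrightarrow> i \<in> T \<Longrightarrow> j \<in> T \<Longrightarrow> i \<noteq> j \<Longrightarrow> d i j \<noteq> d j i" and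
    d2: "\<And>h T i j k. T \<in> faces h \<Longrightarrow> i \<in> T \<Longrightarrow> j \<in> T \<Longrightarrow> k \<in> T \<Longrightarrow> distinct [i, j, k] \<Longrightarrow> d i j \<noteq> d i k"
    using orientation by blast
  define arcs where "arcs T = {(i, j). i \<in> T \<and> j \<in> T \<and> i \<noteq> j \<and> d i j = 0}" for T
  have directed: "arcs T = {(a, b), (b, c), (c, a)}"
    if abc: "T = {a, b, c}" "distinct [a, b, c]"
      and "d a b = 0" "d b c = 0" "d c a = 0" "d b a = 1" "d c b = 1" "d a c = 1" for T a b c
  proof (intro equalityI subsetI)
    fix x assume "x \<in> arcs T"
    then obtain i j where x: "x = (i, j)" "i = a \<or> i = b \<or> i = c" "j = a \<or> j = b \<or> j = c" "i \<noteq> j" "d i j = 0"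
      using abc(1) unfolding arcs_def by blast
    show "x \<in> {(a, b), (b, c), (c, a)}"
      using x(2,3) by (elim disjE) (use x(1,4,5) that(6-8) in simp_all)
  next
    fix x assume "x \<in> {(a, b), (b, c), (c, a)}"
    then show "x \<in> arcs T" using that unfolding arcs_def by (elim insertE) simp_all
  qed
  \<comment> \<open>By \<open>d2\<close> exactly one of the two edges at each corner points
    outwards, and by \<open>d1\<close> both ends agree on the direction, so the triangle is a
    directed cycle.\<close>
  have cyc: "\<exists>a b c. T = {a, b, c} \<and> distinct [a, b, c] \<and> arcs T = {(a, b), (b, c), (c, a)}"
    if T: "T \<in> faces g" for T g
  proof -
    obtain p q r where pqr: "T = {p, q, r}" "distinct [p, q, r]"
      using faces_card[OF T] by (auto simp: card_3_iff)
    have ne: "d p q \<noteq> d q p" "d p r \<noteq> d r p" "d q r \<noteq> d r q" "d p q \<noteq> d p r" "d q p \<noteq> d q r" "d r p \<noteq> d r q"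
      using d1[OF T, of p q] d1[OF T, of p r] d1[OF T, of q r]
        d2[OF T, of p q r] d2[OF T, of q p r] d2[OF T, of r p q] pqr by auto
    show ?thesis
    proof (cases "d p q = 0")
      case zero: True
      have 1: "d q p = 1" "d p r = 1" using ne(1,4) zero by auto
      have 2: "d q r = 0" "d r p = 0" using ne(2,5) 1 by auto
      have 3: "d r q = 1" using ne(3) 2 by auto
      have "arcs T = {(p, q), (q, r), (r, p)}" by (rule directed[OF pqr]) (fact zero 1 2 3)+
      then show ?thesis using pqr by blast
    next
      case False
      then have one: "d p q = 1" by simp
      have 1: "d q p = 0" "d p r = 0" using ne(1,4) one by auto
      have 2: "d q r = 1" "d r p = 1" using ne(2,5) 1 by auto
      have 3: "d r q = 0" using ne(3) 2 by auto
      have prq: "T = {p, r, q}" "distinct [p, r, q]" using pqr by auto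
      have "arcs T = {(p, r), (r, q), (q, p)}" by (rule directed[OF prq]) (fact one 1 2 3)+
      then show ?thesis using prq by blast
    qed
  qed
  have finO: "finite (arcs T)" if T: "T \<in> faces g" for T g
  proof -
    obtain a b c where "arcs T = {(a, b), (b, c), (c, a)}" using cyc[OF T] by blast
    then show ?thesis by simp
  qed
  define N where "N A B = (\<Sum>(i, j)\<in>arcs A \<inter> arcs B. z j - z i)" for A B
  have N_sym: "N A B = N B A" for A B unfolding N_def by (simp add: Int_commute)
  \<comment> \<open>Every arc of \<open>A\<close> lies in exactly one triangle of colour
    \<open>g'\<close> and is an arc of it too, as directions depend on the edge alone.\<close>
  have N_sum: "(\<Sum>B\<in>faces g'. N A B * r B) = (\<Sum>(i, j)\<in>arcs A. (z j - z i) * r (face_at g' i j))"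
    if A: "A \<in> faces g" for A g g' r
  proof -
    have "(\<Union>B\<in>faces g'. arcs A \<inter> arcs B) = arcs A"
    proof -
      have "\<exists>B\<in>faces g'. x \<in> arcs B" if xA: "x \<in> arcs A" for x
      proof -
        obtain i j where x: "x = (i, j)" "i \<in> A" "j \<in> A" "i \<noteq> j" "d i j = 0"
          using xA unfolding arcs_def by blast
        obtain B where "B \<in> faces g'" "i \<in> B" "j \<in> B" using face_exists[OF x(2-4) A] by blast
        then show ?thesis using x unfolding arcs_def by blast
      qed
      then show ?thesis by blast
    qed
    then have "(\<Sum>(i, j)\<in>arcs A. (z j - z i) * r (face_at g' i j))
        = (\<Sum>(i, j)\<in>(\<Union>B\<in>faces g'. arcs A \<inter> arcs B). (z j - z i) * r (face_at g' i j))" by simp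
    also have "\<dots> = (\<Sum>B\<in>faces g'. \<Sum>(i, j)\<in>arcs A \<inter> arcs B. (z j - z i) * r (face_at g' i j))"
    proof (rule sum.UNION_disjoint)
      show "\<forall>B\<in>faces g'. \<forall>B'\<in>faces g'. B \<noteq> B' \<longrightarrow> (arcs A \<inter> arcs B) \<inter> (arcs A \<inter> arcs B') = {}"
      proof (intro ballI impI equals0I)
        fix B B' x assume B: "B \<in> faces g'" "B' \<in> faces g'" "B \<noteq> B'"
          and "x \<in> (arcs A \<inter> arcs B) \<inter> (arcs A \<inter> arcs B')"
        then obtain i j where "i \<in> B" "j \<in> B" "i \<in> B'" "j \<in> B'" "i \<noteq> j" unfolding arcs_def by blast
        then show False using face_unique B by blast
      qed
    qed (use finO[OF A] finite_faces in auto)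
    also have "\<dots> = (\<Sum>B\<in>faces g'. N A B * r B)"
    proof (rule sum.cong[OF refl])
      fix B assume B: "B \<in> faces g'"
      have "(\<Sum>(i, j)\<in>arcs A \<inter> arcs B. (z j - z i) * r (face_at g' i j)) = (\<Sum>(i, j)\<in>arcs A \<inter> arcs B. (z j - z i) * r B)"
        by (rule sum.cong) (auto simp: arcs_def face_at_eq[OF B])
      then show "(\<Sum>(i, j)\<in>arcs A \<inter> arcs B. (z j - z i) * r (face_at g' i j)) = N A B * r B"
        unfolding N_def by (simp add: sum_distrib_right case_prod_unfold)
    qed
    finally show ?thesis by simp
  qed
  have closed: "(\<Sum>(i, j)\<in>arcs A. f j - f i) = 0" if A: "A \<in> faces g" for A g and f :: "nat \<Rightarrow> 'k"
  proof -
    obtain a b c where "distinct [a, b, c]" "arcs A = {(a, b), (b, c), (c, a)}" using cyc[OF A] by blast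
    then show ?thesis by simp
  qed
  obtain s \<beta> where s: "\<And>T i. T \<in> faces h \<Longrightarrow> i \<in> T \<Longrightarrow> y i = s T * z i + \<beta> T"
    using aff unfolding affine_on_def by metis
  \<comment> \<open>Two kernel vectors: the constant 1 comes from \<open>z\<close> itself, and the
    slopes \<open>s\<close> from \<open>y\<close>. In both cases the differences telescope around
    \<open>A\<close>.\<close>
  have ones: "(\<Sum>B\<in>faces h. N A B) = 0" if A: "A \<in> faces h'" for A
    using N_sum[OF A, where g' = h and r = "\<lambda>_. 1"] closed[OF A, of z] by simp
  have slopes: "(\<Sum>B\<in>faces h. N A B * s B) = 0" if A: "A \<in> faces h'" for A
  proof -
    have "(z j - z i) * s (face_at h i j) = y j - y i" if ij: "(i, j) \<in> arcs A" for i j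
    proof -
      obtain B where B: "B \<in> faces h" "i \<in> B" "j \<in> B" "i \<noteq> j"
        using face_exists[of i A j h' h] A ij unfolding arcs_def by blast
      then show ?thesis using face_at_eq[OF B] s[OF B(1)] by (simp add: algebra_simps)
    qed
    then have "(\<Sum>(i, j)\<in>arcs A. (z j - z i) * s (face_at h i j)) = (\<Sum>(i, j)\<in>arcs A. y j - y i)"
      by (intro sum.cong) auto
    then show ?thesis using N_sum[OF A, where g' = h and r = s] closed[OF A, of y] by simp
  qed
  \<comment> \<open>With a common slope \<sigma>, the function \<open>y - \<sigma> * z\<close> would
    be locally constant, hence constant, and \<open>y\<close> affine everywhere.\<close>
  have "\<exists>B0\<in>faces h. \<exists>B1\<in>faces h. s B0 \<noteq> s B1"
  proof (rule ccontr)
    assume "\<not> ?thesis"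
    then have eq: "s B = s B'" if "B \<in> faces h" "B' \<in> faces h" for B B' using that by blast
    have "\<exists>\<sigma>. \<forall>B\<in>faces h. s B = \<sigma>"
    proof (cases "faces h = {}")
      case False
      then obtain B' where "B' \<in> faces h" by blast
      then show ?thesis using eq[of _ B'] by (intro exI[of _ "s B'"] ballI)
    qed simp
    then obtain \<sigma> where \<sigma>: "\<And>B. B \<in> faces h \<Longrightarrow> s B = \<sigma>" by blast
    have loc: "y i - \<sigma> * z i = y j - \<sigma> * z j" if T: "T \<in> faces g" "i \<in> T" "j \<in> T" for g T i j
    proof (cases "i = j")
      case False
      then obtain B where B: "B \<in> faces h" "i \<in> B" "j \<in> B" using face_exists[OF T(2,3) _ T(1)] by blast
      then show ?thesis using s[OF B(1)] \<sigma>[OF B(1)] by simp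
    qed simp
    have "y i = \<sigma> * z i + (y 1 - \<sigma> * z 1)" if "i \<in> {1..n}" for i
    proof -
      have "y i - \<sigma> * z i = y 1 - \<sigma> * z 1"
        by (rule locally_constant[where f = "\<lambda>i. y i - \<sigma> * z i"], erule (2) loc) (use that in auto)
      then show ?thesis by (simp add: algebra_simps)
    qed
    then show False using naff unfolding affine_on_def by blast
  qed
  then obtain B0 B1 where B01: "B0 \<in> faces h" "B1 \<in> faces h" "s B0 \<noteq> s B1" by blast
  \<comment> \<open>Since \<open>N\<close> is symmetric, a nonconstant left kernel vector is a
    nonconstant solution of the slope system for \<open>h'\<close>.\<close>
  obtain t A0 A1 where t: "A0 \<in> faces h'" "A1 \<in> faces h'" "t A0 \<noteq> t A1"
    "\<And>B. B \<in> faces h \<Longrightarrow> (\<Sum>A\<in>faces h'. t A * N A B) = 0"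
    by (rule transpose_kernel_nonconstant[where I = "faces h'" and J = "faces h" and N = N and s = s,
          OF finite_faces finite_faces card_faces_eq ones slopes B01], assumption, assumption, rule that)
  \<comment> \<open>The increments of the function sought, with slope \<open>t T\<close> on each
    triangle \<open>T\<close> of colour \<open>h'\<close>. The cocycle rule is immediate on those
    triangles; around a triangle of colour \<open>h\<close> it is the equation satisfied by
    \<open>t\<close>.\<close>
  define c where "c i j = (if i = j then 0 else (z j - z i) * t (face_at h' i j))" for i j
  have comm: "face_at h' i j = face_at h' j i" for i j unfolding face_at_def by meson
  have anti: "c i j = - c j i" for i j
    unfolding c_def comm[of i j] by (simp add: algebra_simps)
  have diag: "c i i = 0" for i by (simp add: c_def)
  have slope: "c i j = (z j - z i) * t T" if "T \<in> faces h'" "i \<in> T" "j \<in> T" for T i j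
    using that by (auto simp: c_def face_at_eq)
  have cocyc: "c i j + c j k = c i k" if T: "T \<in> faces g" "i \<in> T" "j \<in> T" "k \<in> T" for g T i j k
  proof (cases "g = h'")
    case True
    then have T': "T \<in> faces h'" using T by simp
    show ?thesis unfolding slope[OF T' T(2,3)] slope[OF T' T(3,4)] slope[OF T' T(2,4)]
      by (simp add: algebra_simps)
  next
    case False
    then have "g = h" using \<open>h \<noteq> h'\<close> by (cases g; cases h; cases h') auto
    then have B: "T \<in> faces h" using T by simp
    obtain a b e where abe: "T = {a, b, e}" "distinct [a, b, e]" "arcs T = {(a, b), (b, e), (e, a)}"
      using cyc[OF B] by blast
    have "(\<Sum>A\<in>faces h'. t A * N A T) = (\<Sum>A\<in>faces h'. N T A * t A)"
      by (intro sum.cong) (auto simp: N_sym[of _ T])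
    then have "(\<Sum>(i, j)\<in>arcs T. (z j - z i) * t (face_at h' i j)) = 0"
      using N_sum[OF B, where g' = h' and r = t] t(4)[OF B] by simp
    then have "c a b + c b e + c e a = 0" using abe(2) unfolding abe(3) c_def by (auto simp: add.assoc)
    then have ea: "c e a = - (c a b + c b e)" unfolding eq_neg_iff_add_eq_0 by (simp only: add.commute)
    then have "c a e = c a b + c b e" by (simp add: anti[of a e])
    note vals = diag anti[of b a] anti[of e b] ea this
    have "i = a \<or> i = b \<or> i = e" "j = a \<or> j = b \<or> j = e" "k = a \<or> k = b \<or> k = e"
      using T abe(1) by auto
    then show ?thesis by (elim disjE; simp only: vals; simp)
  qed
  obtain y' where y': "\<And>g T i j. T \<in> faces g \<Longrightarrow> i \<in> T \<Longrightarrow> j \<in> T \<Longrightarrow> c i j = y' j - y' i"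
    using cocycle_exact[of c] diag cocyc by blast
  show ?thesis
  proof (intro exI conjI ballI)
    fix T assume T: "T \<in> faces h'"
    then obtain a where a: "a \<in> T" using faces_card by fastforce
    have "y' i = t T * z i + (y' a - t T * z a)" if "i \<in> T" for i
      using y'[OF T a that] slope[OF T a that] by (simp add: algebra_simps)
    then show "affine_on z y' T" unfolding affine_on_def by blast
  next
    show "\<not> affine_on z y' {1..n}"
    proof
      assume "affine_on z y' {1..n}"
      then obtain \<sigma> \<beta> where y'_aff: "\<And>i. i \<in> {1..n} \<Longrightarrow> y' i = \<sigma> * z i + \<beta>"
        unfolding affine_on_def by blast
      \<comment> \<open>Different points of a triangle have different \<open>z\<close>, so the
        global slope would be that of every triangle, against the choice of
        \<open>t\<close>.\<close>
      have "t T = \<sigma>" if T: "T \<in> faces h'" for T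
      proof -
        obtain i j where ij: "i \<in> T" "j \<in> T" "i \<noteq> j" using faces_card[OF T] by (auto simp: card_3_iff)
        then have "i \<in> {1..n}" "j \<in> {1..n}" using faces_subset[OF T] by auto
        then have "(z j - z i) * t T = (z j - z i) * \<sigma>" "z j - z i \<noteq> 0"
          using y'[OF T ij(1,2)] slope[OF T ij(1,2)] y'_aff z ij(3) by (auto simp: algebra_simps dest: inj_onD)
        then show ?thesis by simp
      qed
      then show False using t(1-3) by metis
    qed
  qed
qed

end

section \<open>Projections from the plane to the line\<close>

text \<open>Over a finite field, one plus the product of all \<open>[:- a, 1:]\<close> takes only
  the value 1 and has no root.\<close>

lemma infinite_alg_closed_field: "infinite (UNIV :: 'k::alg_closed_field set)"
proof
  assume fin: "finite (UNIV :: 'k set)"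
  define p where "p = (\<Prod>a\<in>(UNIV :: 'k set). [:- a, 1:])"
  have "poly (p + 1) x = 1" for x
  proof -
    have "poly p x = (\<Prod>a\<in>UNIV. x - a)" by (simp add: p_def poly_prod)
    also have "\<dots> = 0" using fin by (intro prod_zero) auto
    finally show ?thesis by simp
  qed
  moreover have "degree p = CARD('k)"
    by (simp add: p_def degree_prod_eq_sum_degree)
  then have "degree (p + 1) = CARD('k)" using fin by (subst degree_add_eq_left) (auto simp: card_gt_0_iff)
  then have "degree (p + 1) > 0" using fin by (simp add: card_gt_0_iff)
  ultimately show False using alg_closed_imp_poly_has_root[of "p + 1"] by auto
qed

lemma span_singleton_proj_points:
  fixes v :: "'k::field ^ 'n"
  assumes "v \<noteq> 0" shows "vec.span {v} \<in> proj_points"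
  using assms by (simp add: proj_points_def vec.dim_span_eq_card_independent vec.dependent_single)

lemma proj_points_eq_span:
  assumes "L \<in> proj_points" "v \<in> L" "v \<noteq> 0"
  shows "L = vec.span {v}"
proof
  have L: "vec.subspace L" using assms(1) by (simp add: proj_points_def)
  then show "vec.span {v} \<subseteq> L" using assms(2) by (simp add: vec.span_minimal)
  show "L \<subseteq> vec.span {v}"
  proof
    fix w assume "w \<in> L"
    show "w \<in> vec.span {v}"
    proof (cases "w = 0")
      case False
      obtain c where "w = c *s v"
        using proj_points_proportional[OF assms(1,2) \<open>w \<in> L\<close> assms(3) False] by blast
      then show ?thesis by (auto simp: vec.span_singleton)
    qed (simp add: vec.span_zero)
  qed
qed

lemma proj_map_span_singleton:
  fixes A :: "'k::field ^ 'n ^ 'm"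
  shows "proj_map A (vec.span {v}) = vec.span {A *v v}"
  by (auto simp: vec.span_singleton vector_scalar_commute image_iff)

text \<open>The points are normalised so that their projections lie in the affine chart with coordinate
  \<open>z\<close> on which the form \<open>x $ 1 + a * x $ 2\<close> is one; the \<open>m\<close>-th coordinate is a form not vanishing
  at the centre of the projection.\<close>

lemma proj_collinear_iff_affine_on:
  fixes A :: "'k::field ^ 3 ^ 2" and P :: "'i \<Rightarrow> 'k ^ 3"
  assumes ker: "{x. A *v x = 0} = vec.span {v0}" and v0: "v0 $ m \<noteq> 0"
    and nrm: "\<And>i. i \<in> S \<Longrightarrow> (A *v P i) $ 1 + a * (A *v P i) $ 2 = 1"
    and inj: "inj_on (\<lambda>i. (A *v P i) $ 2) S" and ij: "i0 \<in> S" "j0 \<in> S" "i0 \<noteq> j0"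
  shows "proj_collinear ((\<lambda>i. vec.span {P i}) ` S) \<longleftrightarrow> affine_on (\<lambda>i. (A *v P i) $ 2) (\<lambda>i. P i $ m) S"
    (is "?lhs \<longleftrightarrow> affine_on ?z ?y S")
proof -
  have zne: "?z j0 - ?z i0 \<noteq> 0" using inj ij by (auto dest: inj_onD)
  have Pi: "P i0 \<noteq> 0"
  proof
    assume "P i0 = 0"
    then show False using nrm[OF ij(1)] by simp
  qed
  have nspan: "P j0 \<notin> vec.span {P i0}"
  proof
    assume "P j0 \<in> vec.span {P i0}"
    then obtain c where c: "P j0 = c *s P i0" by (auto simp: vec.span_singleton)
    then have "(A *v P j0) $ 1 + a * (A *v P j0) $ 2 = c * ((A *v P i0) $ 1 + a * (A *v P i0) $ 2)"
      by (simp add: vector_scalar_commute algebra_simps)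
    then have "c = 1" by (simp only: nrm[OF ij(1)] nrm[OF ij(2)] mult_1_right)
    then show False using c zne by simp
  qed
  then have ne: "P j0 \<noteq> P i0" by (metis vec.span_base singletonI)
  have ind: "vec.independent {P j0, P i0}"
    using nspan Pi by (simp add: vec.independent_insert vec.dependent_single)
  have comb: "vec.span {P j0, P i0} = {\<beta> *s P j0 + \<alpha> *s P i0 | \<alpha> \<beta>. True}"
    by (auto simp: vec.span_insert vec.span_singleton algebra_simps) (metis diff_add_cancel add.commute)+
  show ?thesis
  proof
    assume ?lhs
    then obtain H where H: "H \<in> proj_lines" "\<And>i. i \<in> S \<Longrightarrow> vec.span {P i} \<subseteq> H"
      unfolding proj_collinear_def by auto
    have PH: "P i \<in> H" if "i \<in> S" for i using H(2)[OF that] vec.span_base[of "P i" "{P i}"] by auto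
    have "vec.dim H \<le> card {P j0, P i0}" using H(1) ne by (simp add: proj_lines_def)
    then have "H \<subseteq> vec.span {P j0, P i0}"
      using ind PH ij by (intro vec.card_ge_dim_independent) auto
    then have span: "P k \<in> vec.span {P j0, P i0}" if "k \<in> S" for k using PH that by blast
    define \<sigma> where "\<sigma> = (?y j0 - ?y i0) / (?z j0 - ?z i0)"
    have "?y k = \<sigma> * ?z k + (?y i0 - \<sigma> * ?z i0)" if k: "k \<in> S" for k
    proof -
      obtain \<alpha> \<beta> where ab: "P k = \<beta> *s P j0 + \<alpha> *s P i0" using span[OF k] comb by auto
      have "A *v P k = \<beta> *s (A *v P j0) + \<alpha> *s (A *v P i0)"
        by (simp add: ab matrix_vector_right_distrib vector_scalar_commute)
      then have u: "(A *v P k) $ r = \<beta> * (A *v P j0) $ r + \<alpha> * (A *v P i0) $ r" for r by simp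
      \<comment> \<open>Evaluating the normalising form turns the linear combination into an affine
        one.\<close>
      have "1 = \<beta> * ((A *v P j0) $ 1 + a * (A *v P j0) $ 2) + \<alpha> * ((A *v P i0) $ 1 + a * (A *v P i0) $ 2)"
        unfolding nrm[OF k, symmetric] u by (simp add: algebra_simps)
      then have \<alpha>: "\<alpha> = 1 - \<beta>" using nrm[OF ij(1)] nrm[OF ij(2)] by (simp add: algebra_simps)
      have "?z k - ?z i0 = \<beta> * (?z j0 - ?z i0)" by (simp add: u \<alpha> algebra_simps)
      moreover have "?y k - ?y i0 = \<beta> * (?y j0 - ?y i0)" by (simp add: ab \<alpha> algebra_simps)
      ultimately have "?y k - ?y i0 = \<sigma> * (?z k - ?z i0)" using zne by (simp add: \<sigma>_def)
      then show ?thesis by (simp add: algebra_simps)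
    qed
    then show "affine_on ?z ?y S" unfolding affine_on_def by blast
  next
    assume "affine_on ?z ?y S"
    then obtain \<sigma> \<tau> where y: "\<And>i. i \<in> S \<Longrightarrow> ?y i = \<sigma> * ?z i + \<tau>" unfolding affine_on_def by blast
    have Pspan: "P k \<in> vec.span {P j0, P i0}" if k: "k \<in> S" for k
    proof -
      define \<beta> where "\<beta> = (?z k - ?z i0) / (?z j0 - ?z i0)"
      \<comment> \<open>The deviation of \<open>P k\<close> from the line. The normalisation and the
        choice of \<beta> put it in the kernel of \<open>A\<close>, that is, on \<open>v0\<close>;
        affinity of the \<open>m\<close>-th coordinate then makes it vanish.\<close>
      define R where "R = P k - (\<beta> *s P j0 + (1 - \<beta>) *s P i0)"
      have AR: "A *v R = A *v P k - (\<beta> *s (A *v P j0) + (1 - \<beta>) *s (A *v P i0))"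
        by (simp add: R_def matrix_vector_right_distrib matrix_vector_mult_diff_distrib vector_scalar_commute)
      have bz: "\<beta> * (?z j0 - ?z i0) = ?z k - ?z i0" using zne by (simp add: \<beta>_def)
      have bz': "?z k = \<beta> * ?z j0 + (1 - \<beta>) * ?z i0" using bz by (simp add: algebra_simps)
      have R2: "(A *v R) $ 2 = 0" using bz' by (simp add: AR algebra_simps)
      have "(A *v R) $ 1 + a * (A *v R) $ 2 = ((A *v P k) $ 1 + a * (A *v P k) $ 2)
          - (\<beta> * ((A *v P j0) $ 1 + a * (A *v P j0) $ 2) + (1 - \<beta>) * ((A *v P i0) $ 1 + a * (A *v P i0) $ 2))"
        by (simp add: AR algebra_simps)
      also have "\<dots> = 0" by (simp add: nrm[OF k] nrm[OF ij(1)] nrm[OF ij(2)])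
      finally have "(A *v R) $ 1 = 0" using R2 by simp
      then have "A *v R = 0" using R2 by (simp add: vec_eq_iff forall_2)
      then obtain c where c: "R = c *s v0" using ker by (auto simp: vec.span_singleton)
      have "R $ m = ?y k - (\<beta> * ?y j0 + (1 - \<beta>) * ?y i0)"
        by (simp add: R_def algebra_simps)
      also have "\<dots> = 0" unfolding y[OF k] y[OF ij(1)] y[OF ij(2)] bz' by (simp add: algebra_simps)
      finally have "R = 0" using c v0 by simp
      then have "P k = \<beta> *s P j0 + (1 - \<beta>) *s P i0" by (simp add: R_def)
      then show ?thesis using comb by blast
    qed
    have "vec.span {P k} \<subseteq> vec.span {P j0, P i0}" if "k \<in> S" for k
      using Pspan[OF that] by (intro vec.span_minimal) auto
    then have "\<forall>L\<in>(\<lambda>i. vec.span {P i}) ` S. L \<subseteq> vec.span {P j0, P i0}" by blast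
    moreover have "vec.span {P j0, P i0} \<in> proj_lines"
      using ne by (simp add: proj_lines_def vec.dim_eq_card_independent[OF ind])
    ultimately show ?lhs unfolding proj_collinear_def by blast
  qed
qed

text \<open>Chooses a point at infinity away from the marked points. As the coefficient of
  \<open>u i $ 1\<close> is one, the form and the second coordinate together are linear
  coordinates.\<close>

lemma exists_nonvanishing_form:
  fixes u :: "'i \<Rightarrow> 'k::field ^ 2"
  assumes "infinite (UNIV :: 'k set)" "finite I" "\<And>i. i \<in> I \<Longrightarrow> u i \<noteq> 0"
  obtains a where "\<And>i. i \<in> I \<Longrightarrow> u i $ 1 + a * u i $ 2 \<noteq> 0"
proof -
  have "finite ((\<lambda>i. - u i $ 1 / u i $ 2) ` I)" using assms(2) by simp
  then obtain a where a: "a \<notin> (\<lambda>i. - u i $ 1 / u i $ 2) ` I"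
    using ex_new_if_finite[OF assms(1)] by blast
  have "u i $ 1 + a * u i $ 2 \<noteq> 0" if i: "i \<in> I" for i
  proof
    assume eq: "u i $ 1 + a * u i $ 2 = 0"
    show False
    proof (cases "u i $ 2 = 0")
      case True
      then have "u i = 0" using eq by (simp add: vec_eq_iff forall_2)
      then show False using assms(3)[OF i] by simp
    next
      case False
      have "a * u i $ 2 = - u i $ 1" using eq by (simp add: eq_neg_iff_add_eq_0 add.commute)
      then have "a = - u i $ 1 / u i $ 2" using False by (simp add: field_simps)
      then show False using a i by blast
    qed
  qed
  then show thesis using that by blast
qed

text \<open>The points \<open>q\<close> on the line are kept and only their lift to the plane
  changes, so the class \<open>X\<close> stays the same. Over fixed \<open>q\<close>, collinearity
  in a lift depends on the heights alone, and \<open>transfer\<close> supplies new heights.\<close>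

lemma G2_subset:
  fixes \<Gamma> \<Gamma>' :: "nat set set"
  assumes T: "\<And>T. T \<in> \<Gamma> \<union> \<Gamma>' \<Longrightarrow> T \<subseteq> {1..n} \<and> card T = 3" and n: "2 \<le> n"
    and transfer: "\<And>(z :: nat \<Rightarrow> 'k::alg_closed_field) y. inj_on z {1..n} \<Longrightarrow> \<forall>T\<in>\<Gamma>. affine_on z y T \<Longrightarrow>
      \<not> affine_on z y {1..n} \<Longrightarrow> \<exists>y'. (\<forall>T\<in>\<Gamma>'. affine_on z y' T) \<and> \<not> affine_on z y' {1..n}"
  shows "(G2 n \<Gamma> :: 'k pointed_curve set set) \<subseteq> G2 n \<Gamma>'"
proof
  fix X :: "'k pointed_curve set"
  assume "X \<in> G2 n \<Gamma>"
  then obtain q p c where X: "X \<in> open_moduli_space n" "distinct_points n q" "X = iso_rel n `` {line_curve q}"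
    and p: "distinct_points n p" "\<not> proj_collinear (p ` {1..n})" "\<forall>T\<in>\<Gamma>. proj_collinear (p ` T)"
    and c: "c \<in> proj_points" "projects_from n c p q"
    unfolding G2_def by blast
  obtain A :: "'k ^ 3 ^ 2" where A: "{x. A *v x = 0} = c"
    "\<And>i. i \<in> {1..n} \<Longrightarrow> proj_map A (p i) = q i"
    using c(2) unfolding projects_from_def by blast
  have pp: "p i \<in> proj_points" "q i \<in> proj_points" if "i \<in> {1..n}" for i
    using p(1) X(2) that unfolding distinct_points_def by auto
  have "\<exists>v. v \<in> p i \<and> A *v v \<noteq> 0" if "i \<in> {1..n}" for i
    using proj_points_nonzero[OF pp(2)[OF that]] A(2)[OF that] by (metis imageE)
  then obtain P0 where P0: "\<And>i. i \<in> {1..n} \<Longrightarrow> P0 i \<in> p i \<and> A *v P0 i \<noteq> 0" by metis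
  obtain a where a: "\<And>i. i \<in> {1..n} \<Longrightarrow> (A *v P0 i) $ 1 + a * (A *v P0 i) $ 2 \<noteq> 0"
    using exists_nonvanishing_form[OF infinite_alg_closed_field, of "{1..n}" "\<lambda>i. A *v P0 i"] P0 by auto
  define P where "P i = inverse ((A *v P0 i) $ 1 + a * (A *v P0 i) $ 2) *s P0 i" for i
  have P: "(A *v P i) $ 1 + a * (A *v P i) $ 2 = 1" if "i \<in> {1..n}" for i
  proof -
    have "(A *v P i) $ 1 + a * (A *v P i) $ 2 = inverse ((A *v P0 i) $ 1 + a * (A *v P0 i) $ 2) *
        ((A *v P0 i) $ 1 + a * (A *v P0 i) $ 2)"
      by (simp add: P_def vector_scalar_commute algebra_simps)
    then show ?thesis using a[OF that] by simp
  qed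
  have pP: "p i = vec.span {P i}" if i: "i \<in> {1..n}" for i
  proof (rule proj_points_eq_span[OF pp(1)[OF i]])
    show "P i \<in> p i" using pp(1)[OF i] P0[OF i] by (simp add: P_def proj_points_def vec.subspace_scale)
    show "P i \<noteq> 0" using P[OF i] by auto
  qed
  define z where "z i = (A *v P i) $ 2" for i
  have u: "A *v P i = vector [1 - a * z i, z i]" if "i \<in> {1..n}" for i
    using P[OF that] by (simp add: vec_eq_iff forall_2 z_def algebra_simps)
  have qu: "q i = vec.span {vector [1 - a * z i, z i]}" if "i \<in> {1..n}" for i
    using A(2)[OF that] pP[OF that] u[OF that] by (simp add: proj_map_span_singleton)
  have z: "inj_on z {1..n}"
  proof (rule inj_onI)
    fix i j assume ij: "i \<in> {1..n}" "j \<in> {1..n}" "z i = z j"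
    then have "q i = q j" using qu by simp
    then show "i = j" using X(2) ij unfolding distinct_points_def by (auto dest: inj_onD)
  qed
  obtain v0 where v0: "v0 \<in> c" "v0 \<noteq> 0" using proj_points_nonzero[OF c(1)] by blast
  then obtain m where m: "v0 $ m \<noteq> 0" by (auto simp: vec_eq_iff)
  have ker: "{x. A *v x = 0} = vec.span {v0}" using A(1) proj_points_eq_span[OF c(1) v0] by simp
  have two: "\<exists>i\<in>T. \<exists>j\<in>T. i \<noteq> j" if "T \<in> \<Gamma> \<union> \<Gamma>' \<or> T = {1..n}" for T
  proof (cases "T = {1..n}")
    case True
    then show ?thesis using n by (intro bexI[of _ 1] bexI[of _ 2]) auto
  next
    case False
    then have "card T = 3" using that T by blast
    then show ?thesis by (auto simp: card_3_iff)
  qed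
  \<comment> \<open>Stated for any lift, as it serves both the given points with heights
    \<open>P i $ m\<close> and the points \<open>Q\<close> built from the new heights.\<close>
  have iff: "proj_collinear ((\<lambda>i. vec.span {Q i}) ` S) \<longleftrightarrow> affine_on z (\<lambda>i. Q i $ r) S"
    if S: "S \<in> \<Gamma> \<union> \<Gamma>' \<or> S = {1..n}" and B: "{x. B *v x = 0} = vec.span {w}" "w $ r \<noteq> 0"
      "\<And>i. i \<in> {1..n} \<Longrightarrow> B *v Q i = vector [1 - a * z i, z i]"
    for S and B :: "'k ^ 3 ^ 2" and Q r w
  proof -
    have Sn: "i \<in> {1..n}" if "i \<in> S" for i using T S that by blast
    have zB: "(B *v Q i) $ 2 = z i" if "i \<in> S" for i using B(3)[OF Sn[OF that]] by simp
    obtain i j where "i \<in> S" "j \<in> S" "i \<noteq> j" using two[OF S] by blast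
    moreover have "inj_on (\<lambda>i. (B *v Q i) $ 2) S"
      using z zB Sn by (intro inj_onI) (metis inj_onD)
    moreover have "(B *v Q i) $ 1 + a * (B *v Q i) $ 2 = 1" if "i \<in> S" for i
      using B(3)[OF Sn[OF that]] by simp
    ultimately have "proj_collinear ((\<lambda>i. vec.span {Q i}) ` S) \<longleftrightarrow>
        affine_on (\<lambda>i. (B *v Q i) $ 2) (\<lambda>i. Q i $ r) S"
      by (intro proj_collinear_iff_affine_on[OF B(1,2)])
    also have "\<dots> \<longleftrightarrow> affine_on z (\<lambda>i. Q i $ r) S"
      unfolding affine_on_def by (simp add: zB)
    finally show ?thesis .
  qed
  have image: "p ` S = (\<lambda>i. vec.span {P i}) ` S" if "S \<subseteq> {1..n}" for S
    using that pP by (intro image_cong) auto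
  have "affine_on z (\<lambda>i. P i $ m) S" if S: "S \<in> \<Gamma>" for S
  proof -
    have "S \<subseteq> {1..n}" using T S by blast
    then have "proj_collinear ((\<lambda>i. vec.span {P i}) ` S)" using p(3) S by (simp flip: image)
    then show ?thesis using iff[OF _ ker m u, of S] S by blast
  qed
  moreover have "\<not> affine_on z (\<lambda>i. P i $ m) {1..n}"
    using iff[OF _ ker m u, of "{1..n}"] p(2) image[of "{1..n}"] by simp
  ultimately obtain y where y: "\<forall>T\<in>\<Gamma>'. affine_on z y T" "\<not> affine_on z y {1..n}"
    using transfer[OF z, of "\<lambda>i. P i $ m"] by blast
  \<comment> \<open>Forgetting the third coordinate, a projection from
    \<open>vector [0, 0, 1]\<close>, returns the representatives of \<open>q\<close> found above;
    that coordinate holds the new heights.\<close>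
  define B :: "'k ^ 3 ^ 2" where "B = vector [vector [1, 0, 0], vector [0, 1, 0]]"
  define Q :: "nat \<Rightarrow> 'k ^ 3" where "Q i = vector [1 - a * z i, z i, y i]" for i
  have Bx: "B *v x = vector [x $ 1, x $ 2]" for x
    by (simp add: B_def vec_eq_iff forall_2 matrix_vector_mult_def sum_3)
  have BQ: "B *v Q i = vector [1 - a * z i, z i]" for i by (simp add: Bx Q_def)
  have kerB: "{x. B *v x = 0} = vec.span {vector [0, 0, 1]}"
  proof -
    have "x = x $ 3 *s vector [0, 0, 1]" if "x $ 1 = 0" "x $ 2 = 0" for x :: "'k ^ 3"
      using that by (simp add: vec_eq_iff forall_3)
    then show ?thesis by (auto simp: Bx vec_eq_iff[of _ "0 :: 'k ^ 2"] forall_2 vec.span_singleton)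
  qed
  have w: "(vector [0, 0, 1] :: 'k ^ 3) $ 3 \<noteq> 0" by simp
  have Qy: "Q i $ 3 = y i" for i by (simp add: Q_def)
  have iffQ: "proj_collinear ((\<lambda>i. vec.span {Q i}) ` S) \<longleftrightarrow> affine_on z y S"
    if "S \<in> \<Gamma>' \<or> S = {1..n}" for S
    using iff[OF _ kerB w BQ, of S] that by (auto simp: Qy)
  define p' where "p' i = vec.span {Q i}" for i
  have BQ0: "B *v Q i \<noteq> 0" if "i \<in> {1..n}" for i
  proof
    assume "B *v Q i = 0"
    then have "1 - a * z i = 0" "z i = 0" by (auto simp: BQ vec_eq_iff forall_2)
    then show False by simp
  qed
  have Bp': "proj_map B (p' i) = q i" if "i \<in> {1..n}" for i
    using qu[OF that] by (simp add: p'_def proj_map_span_singleton BQ)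
  have "distinct_points n p'"
    unfolding distinct_points_def
  proof
    have "Q i \<noteq> 0" if "i \<in> {1..n}" for i using BQ0[OF that] by auto
    then show "p' ` {1..n} \<subseteq> proj_points" unfolding p'_def by (auto intro: span_singleton_proj_points)
    show "inj_on p' {1..n}"
    proof (rule inj_onI)
      fix i j assume ij: "i \<in> {1..n}" "j \<in> {1..n}" "p' i = p' j"
      then have "q i = q j" using Bp' by metis
      then show "i = j" using X(2) ij unfolding distinct_points_def by (auto dest: inj_onD)
    qed
  qed
  moreover have "\<not> proj_collinear (p' ` {1..n})" using iffQ[of "{1..n}"] y(2) by (simp add: p'_def)
  moreover have "\<forall>T\<in>\<Gamma>'. proj_collinear (p' ` T)" using iffQ y(1) by (simp add: p'_def)
  moreover have "vec.span {vector [0, 0, 1] :: 'k ^ 3} \<in> proj_points"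
    by (rule span_singleton_proj_points) (use w in \<open>metis zero_index\<close>)
  moreover have "projects_from n (vec.span {vector [0, 0, 1]}) p' q"
    unfolding projects_from_def
  proof (intro exI conjI ballI)
    show "{x. B *v x = 0} = vec.span {vector [0, 0, 1]}" by (rule kerB)
    fix i assume i: "i \<in> {1..n}"
    show "proj_map B (p' i) = q i" by (rule Bp'[OF i])
    have "Q i \<in> p' i" unfolding p'_def by (rule vec.span_base) simp
    then show "p' i \<noteq> vec.span {vector [0, 0, 1]}" using BQ0[OF i] kerB by blast
  qed
  ultimately show "X \<in> G2 n \<Gamma>'" using X unfolding G2_def by blast
qed

theorem corollary8p4:
  fixes n :: nat
    and K :: "'a::euclidean_space set set"
    and col :: "'a set \<Rightarrow> colour"
    and vert :: "nat \<Rightarrow> 'a"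
  assumes "even_sphere_triangulation K col"
    and "vertex_labelling n K vert"
  shows "(D n (hypertree n K col vert Black) :: 'k::alg_closed_field pointed_curve set set)
       = D n (hypertree n K col vert White)"
proof -
  interpret labelled_even_sphere n K col vert by unfold_locales fact+
  have "(G2 n (faces h) :: 'k pointed_curve set set) \<subseteq> G2 n (faces h')" if hh: "h \<noteq> h'" for h h'
  \<comment> \<open>A triangle provides the lower bound on \<open>n\<close>; if there is none,
    equality of the counts makes both collections empty.\<close>
  proof (cases "faces h = {}")
    case True
    then have "faces h' = {}" using card_faces_eq[of h h'] finite_faces[of h'] by simp
    then show ?thesis using True by simp
  next
    case False
    then obtain T where "T \<in> faces h" by blast
    then have "3 \<le> n" using faces_card faces_subset card_mono[of "{1..n}" T] by fastforce
    show ?thesis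
    proof (rule G2_subset)
      show "\<exists>y'. (\<forall>T\<in>faces h'. affine_on z y' T) \<and> \<not> affine_on z y' {1..n}"
        if "inj_on z {1..n}" "\<forall>T\<in>faces h. affine_on z y T" "\<not> affine_on z y {1..n}" for z y :: "nat \<Rightarrow> 'k"
        using that by (intro affine_transfer[OF _ hh])
      show "T \<subseteq> {1..n} \<and> card T = 3" if "T \<in> faces h \<union> faces h'" for T
        using that faces_card faces_subset by blast
      show "2 \<le> n" using \<open>3 \<le> n\<close> by simp
    qed
  qed
  then have "(G2 n (faces Black) :: 'k pointed_curve set set) = G2 n (faces White)"
    by (intro equalityI) auto
  then show ?thesis by (simp add: D_def)
qed

end
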